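(* Let $(K,\mathcal{L})$ be a $C$-minimal valued field and let $f\colon X\subseteq K\to K$ be a definable local $C$-isomorphism. Then there is a finite subset $F\subseteq X$ such that $f|(X\setminus F)$ locally factorizes over $\Gamma$ through a definable function $h$.
   Context: Valued fields $(K,v)$ are non-trivially valued; $\Gamma_K$ is the value group. Closed balls are $B(a,\gamma)=\{x\in K: v(x-a)\geq\gamma\}$ for $a \in K$, $\gamma\in\Gamma_K\cup\{+\infty\}$; open balls are $B^\circ(a,\gamma)=\{x\in K: v(x-a)>\gamma\}$ for $a\in K$, $\gamma\in\Gamma_K\cup\{-\infty\}$ (so points are closed balls and $K$ is an open ball). A ball is a closed or an open ball. $\mathcal{L}_{div}=(+,-,\cdot,0,1,\mathrm{div})$ is the language of valued fields, with $\mathrm{div}(x,y)$ interpreted as $v(x)\leq v(y)$. Let $K$ be an algebraically closed valued field and $(K,\mathcal{L})$ an expansion of $(K,\mathcal{L}_{div})$ ($\mathcal{L}\supseteq\mathcal{L}_{div}$). $(K,\mathcal{L})$ is $C$-minimal (a "$C$-minimal valued field") if for every structure $(K',\mathcal{L})$ elementarily equivalent to it, every $\mathcal{L}$-definable subset of $K'$ is a boolean combination of balls. "Definable" means $\mathcal{L}$-definable with parameters; for subsets of (products involving) $\Gamma_K$ it means interpretable. The $C$-relation on $K$ is $C(x,y,z)\Leftrightarrow v(x-y)=v(x-z)<v(y-z)$. For an open ball $B\subseteq K$, a function $f\colon B\to K$ is a $C$-isomorphism if $f(B)$ is an open ball and for all $x,y,z\in B$, $C(x,y,z)\Leftrightarrow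 C(f(x),f(y),f(z))$. A function $f\colon X\subseteq K\to K$ is a local $C$-isomorphism if every $x\in X$ lies in an open ball $B\subseteq X$ such that $f|B$ is a $C$-isomorphism. A function $f\colon X\subseteq K\to K$ factorizes over $\Gamma$ through a (possibly partial) function $h\colon\Gamma_K\to\Gamma_K$ if $v(f(x)-f(y))=h(v(x-y))$ for all distinct $x,y\in X$. For $h\colon Y\subseteq X\times\Gamma_K\to\Gamma_K$, with $h_x(\gamma):=h(x,\gamma)$, $f$ locally factorizes over $\Gamma$ through $h$ if for every $x\in X$ there is an open ball $B_x\subseteq X$ containing $x$ such that $f|B_x$ factorizes over $\Gamma$ through $h_x$. *)

theory Defs
  imports "HOL-Library.Extended" "HOL-Computational_Algebra.Polynomial"
begin

section \<open>First-order logic\<close>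

text \<open>A symbol of a language is a name together with an arity.\<close>

record ('f, 'r) language =
  fun_syms :: "('f \<times> nat) set"
  rel_syms :: "('r \<times> nat) set"

datatype 'f fterm = Var nat | App 'f "'f fterm list"

datatype ('f, 'r) form =
    Eq "'f fterm" "'f fterm"
  | Rel 'r "'f fterm list"
  | Neg "('f, 'r) form"
  | Conj "('f, 'r) form" "('f, 'r) form"
  | Ex nat "('f, 'r) form"

primrec term_in :: "('f, 'r) language \<Rightarrow> 'f fterm \<Rightarrow> bool" where
  "term_in L (Var i) \<longleftrightarrow> True"
| "term_in L (App g ts) \<longleftrightarrow> (g, length ts) \<in> fun_syms L \<and> list_all (term_in L) ts"

primrec form_in :: "('f, 'r) language \<Rightarrow> ('f, 'r) form \<Rightarrow> bool" where
  "form_in L (Eq s t) \<longleftrightarrow> term_in L s \<and> term_in L t"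
| "form_in L (Rel r ts) \<longleftrightarrow> (r, length ts) \<in> rel_syms L \<and> list_all (term_in L) ts"
| "form_in L (Neg p) \<longleftrightarrow> form_in L p"
| "form_in L (Conj p q) \<longleftrightarrow> form_in L p \<and> form_in L q"
| "form_in L (Ex i p) \<longleftrightarrow> form_in L p"

primrec term_vars :: "'f fterm \<Rightarrow> nat set" where
  "term_vars (Var i) = {i}"
| "term_vars (App g ts) = \<Union> (set (map term_vars ts))"

primrec free_vars :: "('f, 'r) form \<Rightarrow> nat set" where
  "free_vars (Eq s t) = term_vars s \<union> term_vars t"
| "free_vars (Rel r ts) = \<Union> (set (map term_vars ts))"
| "free_vars (Neg p) = free_vars p"
| "free_vars (Conj p q) = free_vars p \<union> free_vars q"
| "free_vars (Ex i p) = free_vars p - {i}"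

text \<open>The universe is a set rather than a whole type, so that all structures with universe
  contained in a given type can be quantified over. Only the interpretations of the symbols
  of the language at hand matter.\<close>

record ('f, 'r, 'u) struct =
  univ :: "'u set"
  fun_interp :: "'f \<Rightarrow> 'u list \<Rightarrow> 'u"
  rel_interp :: "'r \<Rightarrow> 'u list \<Rightarrow> bool"

definition tuples :: "('f, 'r, 'u) struct \<Rightarrow> nat \<Rightarrow> 'u list set" where
  "tuples M n = {xs. length xs = n \<and> set xs \<subseteq> univ M}"

definition is_struct :: "('f, 'r) language \<Rightarrow> ('f, 'r, 'u) struct \<Rightarrow> bool" where
  "is_struct L M \<longleftrightarrow> univ M \<noteq> {} \<and>
     (\<forall>(g, n) \<in> fun_syms L. \<forall>xs \<in> tuples M n. fun_interp M g xs \<in> univ M)"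

primrec term_val :: "('f, 'r, 'u) struct \<Rightarrow> (nat \<Rightarrow> 'u) \<Rightarrow> 'f fterm \<Rightarrow> 'u" where
  "term_val M e (Var i) = e i"
| "term_val M e (App g ts) = fun_interp M g (map (term_val M e) ts)"

primrec sat :: "('f, 'r, 'u) struct \<Rightarrow> (nat \<Rightarrow> 'u) \<Rightarrow> ('f, 'r) form \<Rightarrow> bool" where
  "sat M e (Eq s t) \<longleftrightarrow> term_val M e s = term_val M e t"
| "sat M e (Rel r ts) \<longleftrightarrow> rel_interp M r (map (term_val M e) ts)"
| "sat M e (Neg p) \<longleftrightarrow> \<not> sat M e p"
| "sat M e (Conj p q) \<longleftrightarrow> sat M e p \<and> sat M e q"
| "sat M e (Ex i p) \<longleftrightarrow> (\<exists>a \<in> univ M. sat M (e(i := a)) p)"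

definition elem_equiv ::
  "('f, 'r) language \<Rightarrow> ('f, 'r, 'u) struct \<Rightarrow> ('f, 'r, 'w) struct \<Rightarrow> bool" where
  "elem_equiv L M N \<longleftrightarrow>
     (\<forall>p. form_in L p \<and> free_vars p = {} \<longrightarrow>
        ((\<forall>e. range e \<subseteq> univ M \<longrightarrow> sat M e p) \<longleftrightarrow> (\<forall>e. range e \<subseteq> univ N \<longrightarrow> sat N e p)))"

text \<open>Definability with parameters: the variables below \<open>n\<close> are the coordinates, and the
  assignment \<open>e\<close> supplies parameters for the remaining free variables.\<close>

definition definable ::
  "('f, 'r) language \<Rightarrow> ('f, 'r, 'u) struct \<Rightarrow> nat \<Rightarrow> 'u list set \<Rightarrow> bool" where
  "definable L M n S \<longleftrightarrow>
     (\<exists>p e. form_in L p \<and> range e \<subseteq> univ M \<and>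
        S = {xs \<in> tuples M n. sat M (\<lambda>i. if i < n then xs ! i else e i) p})"

section \<open>Valued fields\<close>

text \<open>The type \<open>'g\<close> is the value group, so \<open>v\<close> is required to be onto it; \<open>'g extended\<close> adds
  the two elements \<open>Pinf\<close> and \<open>Minf\<close>, of which only \<open>Pinf\<close> is a value of \<open>v\<close>.\<close>

definition valuation :: "('a::field \<Rightarrow> 'g::linordered_ab_group_add extended) \<Rightarrow> bool" where
  "valuation v \<longleftrightarrow>
     (\<forall>x. v x = Pinf \<longleftrightarrow> x = 0) \<and>
     (\<forall>x. v x \<noteq> Minf) \<and>
     (\<forall>x y. v (x * y) = v x + v y) \<and>
     (\<forall>x y. min (v x) (v y) \<le> v (x + y)) \<and>
     (\<forall>\<gamma>. \<exists>x. v x = Fin \<gamma>)"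

definition nontrivial_valuation ::
  "('a::field \<Rightarrow> 'g::linordered_ab_group_add extended) \<Rightarrow> bool" where
  "nontrivial_valuation v \<longleftrightarrow> valuation v \<and> (\<exists>x. x \<noteq> 0 \<and> v x \<noteq> 0)"

definition is_closed_ball ::
  "('a::field \<Rightarrow> 'g::linordered_ab_group_add extended) \<Rightarrow> 'a set \<Rightarrow> bool" where
  "is_closed_ball v B \<longleftrightarrow> (\<exists>a \<gamma>. \<gamma> \<noteq> Minf \<and> B = {x. v (x - a) \<ge> \<gamma>})"

definition is_open_ball ::
  "('a::field \<Rightarrow> 'g::linordered_ab_group_add extended) \<Rightarrow> 'a set \<Rightarrow> bool" where
  "is_open_ball v B \<longleftrightarrow> (\<exists>a \<gamma>. \<gamma> \<noteq> Pinf \<and> B = {x. v (x - a) > \<gamma>})"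

section \<open>Expansions of valued fields\<close>

text \<open>Besides the symbols of \<open>L\<^sub>d\<^sub>i\<^sub>v\<close>, a language may use arbitrary further names.\<close>

datatype 'f vf_fun = Plus | Minus | Times | Zero | One | ExtraFun 'f
datatype 'r vf_rel = Div | ExtraRel 'r

definition L_div :: "('f vf_fun, 'r vf_rel) language" where
  "L_div = \<lparr>fun_syms = {(Plus, 2), (Minus, 2), (Times, 2), (Zero, 0), (One, 0)},
            rel_syms = {(Div, 2)}\<rparr>"

definition extends_L_div :: "('f vf_fun, 'r vf_rel) language \<Rightarrow> bool" where
  "extends_L_div L \<longleftrightarrow>
     fun_syms (L_div :: ('f vf_fun, 'r vf_rel) language) \<subseteq> fun_syms L \<and>
     rel_syms (L_div :: ('f vf_fun, 'r vf_rel) language) \<subseteq> rel_syms L"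

definition expands_valued_field ::
  "('a::field \<Rightarrow> 'g::linordered_ab_group_add extended) \<Rightarrow>
   ('f vf_fun, 'r vf_rel, 'a) struct \<Rightarrow> bool" where
  "expands_valued_field v M \<longleftrightarrow>
     univ M = UNIV \<and>
     (\<forall>x y. fun_interp M Plus [x, y] = x + y) \<and>
     (\<forall>x y. fun_interp M Minus [x, y] = x - y) \<and>
     (\<forall>x y. fun_interp M Times [x, y] = x * y) \<and>
     fun_interp M Zero [] = 0 \<and>
     fun_interp M One [] = 1 \<and>
     (\<forall>x y. rel_interp M Div [x, y] \<longleftrightarrow> v x \<le> v y)"

text \<open>A structure \<open>N\<close> elementarily equivalent to an expansion of a valued field is itself an
  expansion of a valued field, whose valuation is given by \<open>Div\<close>: \<open>v x \<le> v y\<close> iff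
  \<open>Div x y\<close>. Its value group is by definition the set of values of nonzero elements, so every
  radius in the value group is the value of some \<open>c \<noteq> 0\<close>, and the radius \<open>Pinf\<close> is the value
  of \<open>0\<close>. This gives the following description of the balls of \<open>N\<close>; the lemma
  \<open>struct_ball_iff\<close> confirms that it agrees with the one in terms of the valuation.\<close>

definition struct_closed_ball :: "('f vf_fun, 'r vf_rel, 'u) struct \<Rightarrow> 'u set \<Rightarrow> bool" where
  "struct_closed_ball N B \<longleftrightarrow>
     (\<exists>a \<in> univ N. \<exists>c \<in> univ N.
        B = {x \<in> univ N. rel_interp N Div [c, fun_interp N Minus [x, a]]})"

definition struct_open_ball :: "('f vf_fun, 'r vf_rel, 'u) struct \<Rightarrow> 'u set \<Rightarrow> bool" where
  "struct_open_ball N B \<longleftrightarrow>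
     B = univ N \<or>
     (\<exists>a \<in> univ N. \<exists>c \<in> univ N. c \<noteq> fun_interp N Zero [] \<and>
        B = {x \<in> univ N. \<not> rel_interp N Div [fun_interp N Minus [x, a], c]})"

lemma struct_ball_iff:
  assumes "valuation v" "expands_valued_field v M"
  shows "struct_closed_ball M B \<longleftrightarrow> is_closed_ball v B"
    and "struct_open_ball M B \<longleftrightarrow> is_open_ball v B"
proof -
  have M: "univ M = UNIV" "\<And>x y. fun_interp M Minus [x, y] = x - y"
    "fun_interp M Zero [] = 0" "\<And>x y. rel_interp M Div [x, y] \<longleftrightarrow> v x \<le> v y"
    using assms(2) by (auto simp: expands_valued_field_def)
  have v0: "v x = Pinf \<longleftrightarrow> x = 0" and vM: "v x \<noteq> Minf" for x
    using assms(1) by (auto simp: valuation_def)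
  have rad: "\<exists>c. v c = \<gamma>" if "\<gamma> \<noteq> Minf" for \<gamma>
    using that assms(1) unfolding valuation_def by (cases \<gamma>) auto
  show "struct_closed_ball M B \<longleftrightarrow> is_closed_ball v B"
    unfolding struct_closed_ball_def is_closed_ball_def M
    using rad vM by simp metis
  have whole: "{x. Minf < v (x - a)} = UNIV" for a
    using vM by (auto simp: less_le) (metis vM)
  show "struct_open_ball M B \<longleftrightarrow> is_open_ball v B"
  proof
    assume "struct_open_ball M B"
    then consider "B = UNIV" | a c where "c \<noteq> 0" "B = {x. v (x - a) > v c}"
      unfolding struct_open_ball_def M by (auto simp: not_le)
    then show "is_open_ball v B"
      unfolding is_open_ball_def using whole v0 by cases (metis extended.distinct(5), metis)
  next
    assume "is_open_ball v B"
    then obtain a \<gamma> where B: "\<gamma> \<noteq> Pinf" "B = {x. v (x - a) > \<gamma>}"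
      unfolding is_open_ball_def by auto
    show "struct_open_ball M B"
    proof (cases "\<gamma> = Minf")
      case True
      then show ?thesis using B whole by (simp add: struct_open_ball_def M)
    next
      case False
      then obtain c where "v c = \<gamma>" using rad by blast
      then show ?thesis
        using B v0 unfolding struct_open_ball_def M by (auto simp: not_le)
    qed
  qed
qed

inductive_set boolean_combinations :: "'u set \<Rightarrow> 'u set set \<Rightarrow> 'u set set"
  for \<Omega> :: "'u set" and \<B> :: "'u set set" where
  base: "B \<in> \<B> \<Longrightarrow> B \<in> boolean_combinations \<Omega> \<B>"
| compl: "A \<in> boolean_combinations \<Omega> \<B> \<Longrightarrow> \<Omega> - A \<in> boolean_combinations \<Omega> \<B>"
| inter: "A \<in> boolean_combinations \<Omega> \<B> \<Longrightarrow> B \<in> boolean_combinations \<Omega> \<B> \<Longrightarrow>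
    A \<inter> B \<in> boolean_combinations \<Omega> \<B>"
| union: "A \<in> boolean_combinations \<Omega> \<B> \<Longrightarrow> B \<in> boolean_combinations \<Omega> \<B> \<Longrightarrow>
    A \<union> B \<in> boolean_combinations \<Omega> \<B>"

section \<open>C-minimality\<close>

text \<open>HOL cannot quantify over all structures of arbitrary type, so the structures elementarily
  equivalent to \<open>M\<close> range over those with universe inside the type \<open>('a, 'f, 'r) large\<close>. This
  type is infinite and at least as large as the set of formulas with parameters from \<open>'a\<close> (its
  cardinality is at least two to the power of that of \<open>nat \<Rightarrow> 'a + 'f + 'r\<close>), so nothing is
  lost: if some definable set in some structure elementarily equivalent to \<open>M\<close> fails to be a
  boolean combination of balls, then by the downward Loewenheim-Skolem theorem the same happens
  in an elementary substructure, containing the parameters of the definable set, whose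
  cardinality is at most that of the set of formulas. (That a given set is a boolean combination
  of at most \<open>n\<close> balls is a first-order property of the parameters.)\<close>

type_synonym ('a, 'f, 'r) large = "(nat \<Rightarrow> 'a + 'f + 'r) set"

definition C_minimal ::
  "('f vf_fun, 'r vf_rel) language \<Rightarrow> ('f vf_fun, 'r vf_rel, 'a) struct \<Rightarrow> bool" where
  "C_minimal L M \<longleftrightarrow>
     (\<forall>N :: ('f vf_fun, 'r vf_rel, ('a, 'f, 'r) large) struct.
        is_struct L N \<and> elem_equiv L M N \<longrightarrow>
        (\<forall>S. definable L N 1 S \<longrightarrow>
           {x. [x] \<in> S} \<in> boolean_combinations (univ N)
             {B. struct_closed_ball N B \<or> struct_open_ball N B}))"

definition C_minimal_valued_field ::
  "('a::alg_closed_field \<Rightarrow> 'g::linordered_ab_group_add extended) \<Rightarrow>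
   ('f vf_fun, 'r vf_rel) language \<Rightarrow> ('f vf_fun, 'r vf_rel, 'a) struct \<Rightarrow> bool" where
  "C_minimal_valued_field v L M \<longleftrightarrow>
     nontrivial_valuation v \<and> extends_L_div L \<and> is_struct L M \<and>
     expands_valued_field v M \<and> C_minimal L M"

section \<open>Local C-isomorphisms and factorization over the value group\<close>

text \<open>A function \<open>f : X \<rightarrow> K\<close> with \<open>X \<subseteq> K\<close> is given by the set \<open>X\<close> and a total function
  \<open>f\<close> of which only the values on \<open>X\<close> are used.\<close>

definition definable_fun ::
  "('f, 'r) language \<Rightarrow> ('f, 'r, 'a) struct \<Rightarrow> 'a set \<Rightarrow> ('a \<Rightarrow> 'a) \<Rightarrow> bool" where
  "definable_fun L M X f \<longleftrightarrow> definable L M 2 {[x, f x] | x. x \<in> X}"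

text \<open>A partial function \<open>h\<close> on \<open>K \<times> \<Gamma>\<close> with values in \<open>\<Gamma>\<close> is definable if its graph is
  interpretable, \<open>\<Gamma>\<close> being a quotient of the set of nonzero elements of \<open>K\<close> by a definable
  equivalence relation: the preimage of the graph in \<open>K \<times> K \<times> K\<close> is definable.\<close>

definition definable_value_fun ::
  "('a \<Rightarrow> 'g extended) \<Rightarrow> ('f, 'r) language \<Rightarrow> ('f, 'r, 'a) struct \<Rightarrow>
   ('a \<Rightarrow> 'g \<Rightarrow> 'g option) \<Rightarrow> bool" where
  "definable_value_fun v L M h \<longleftrightarrow>
     definable L M 3 {[x, y, z] | x y z. \<exists>\<gamma> \<delta>. v y = Fin \<gamma> \<and> v z = Fin \<delta> \<and> h x \<gamma> = Some \<delta>}"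

definition C_rel :: "('a::field \<Rightarrow> 'g::linordered_ab_group_add extended) \<Rightarrow> 'a \<Rightarrow> 'a \<Rightarrow> 'a \<Rightarrow> bool"
  where "C_rel v x y z \<longleftrightarrow> v (x - y) = v (x - z) \<and> v (x - z) < v (y - z)"

definition C_isomorphism ::
  "('a::field \<Rightarrow> 'g::linordered_ab_group_add extended) \<Rightarrow> 'a set \<Rightarrow> ('a \<Rightarrow> 'a) \<Rightarrow> bool" where
  "C_isomorphism v B f \<longleftrightarrow>
     is_open_ball v B \<and> is_open_ball v (f ` B) \<and>
     (\<forall>x \<in> B. \<forall>y \<in> B. \<forall>z \<in> B. C_rel v x y z \<longleftrightarrow> C_rel v (f x) (f y) (f z))"

definition local_C_isomorphism ::
  "('a::field \<Rightarrow> 'g::linordered_ab_group_add extended) \<Rightarrow> 'a set \<Rightarrow> ('a \<Rightarrow> 'a) \<Rightarrow> bool" where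
  "local_C_isomorphism v X f \<longleftrightarrow>
     (\<forall>x \<in> X. \<exists>B. is_open_ball v B \<and> x \<in> B \<and> B \<subseteq> X \<and> C_isomorphism v B f)"

definition factorizes ::
  "('a::field \<Rightarrow> 'g::linordered_ab_group_add extended) \<Rightarrow> 'a set \<Rightarrow> ('a \<Rightarrow> 'a) \<Rightarrow>
   ('g \<Rightarrow> 'g option) \<Rightarrow> bool" where
  "factorizes v X f h \<longleftrightarrow>
     (\<forall>x \<in> X. \<forall>y \<in> X. x \<noteq> y \<longrightarrow>
        (\<exists>\<gamma> \<delta>. v (x - y) = Fin \<gamma> \<and> h \<gamma> = Some \<delta> \<and> v (f x - f y) = Fin \<delta>))"

text \<open>The first conjunct says that the domain of \<open>h\<close> is contained in \<open>X \<times> \<Gamma>\<close>.\<close>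

definition locally_factorizes ::
  "('a::field \<Rightarrow> 'g::linordered_ab_group_add extended) \<Rightarrow> 'a set \<Rightarrow> ('a \<Rightarrow> 'a) \<Rightarrow>
   ('a \<Rightarrow> 'g \<Rightarrow> 'g option) \<Rightarrow> bool" where
  "locally_factorizes v X f h \<longleftrightarrow>
     (\<forall>x \<gamma>. h x \<gamma> \<noteq> None \<longrightarrow> x \<in> X) \<and>
     (\<forall>x \<in> X. \<exists>B. is_open_ball v B \<and> x \<in> B \<and> B \<subseteq> X \<and> factorizes v B f (h x))"

end

theory Submission
  imports Defs
begin

text \<open>For \<open>c \<noteq> 0\<close> put \<open>g\<^sub>c y = v (f y - f (y + c))\<close>. On a ball where \<open>f\<close> is a C-isomorphism,
  \<open>v (f y - f z)\<close> depends only on \<open>y\<close> and \<open>v (y - z)\<close>, so \<open>f\<close> factorizes over the value group on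
  every subball where \<open>g\<^sub>c\<close> is constant for all small \<open>c\<close>. By C-minimality and compactness (here
  an ultrapower) the sets \<open>{y. g\<^sub>c y < g\<^sub>c z}\<close> are boolean combinations of at most \<open>n\<close> balls, with
  \<open>n\<close> independent of \<open>c\<close> and \<open>z\<close>. In a closed ball such a set contains or avoids all but \<open>n\<close> of
  the residue classes, so among any \<open>2 n + 1\<close> classes there is one on which \<open>g\<^sub>c\<close> is constant.
  Since the residue field is infinite, fix \<open>2 n + 1\<close> classes; a definable set of \<open>c\<close> contains
  either all or no sufficiently small \<open>c \<noteq> 0\<close>, so one of them works for all small \<open>c\<close>. Hence the
  definable set of points without a ball on which \<open>f\<close> factorizes has empty interior, and is
  therefore finite.\<close>

section \<open>Countable ultrapowers\<close>

text \<open>The ultrafilter is given as a quantifier: \<open>ev P\<close> says that \<open>P\<close>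
  holds for almost all indices. Closure under larger sets follows from \<open>ev_conj\<close>, and
  \<open>ev_ge\<close> excludes principal ultrafilters.\<close>

locale free_ultrafilter =
  fixes ev :: "(nat \<Rightarrow> bool) \<Rightarrow> bool"
  assumes ev_not: "ev (\<lambda>n. \<not> P n) \<longleftrightarrow> \<not> ev P"
    and ev_conj: "ev (\<lambda>n. P n \<and> Q n) \<longleftrightarrow> ev P \<and> ev Q"
    and ev_ge: "ev (\<lambda>n. k \<le> n)"
begin

lemma ev_mono: "ev P \<Longrightarrow> (\<And>n. P n \<Longrightarrow> Q n) \<Longrightarrow> ev Q"
proof -
  assume "ev P" and imp: "\<And>n. P n \<Longrightarrow> Q n"
  moreover have "(\<lambda>n. P n \<and> Q n) = P"
    using imp by auto
  ultimately show "ev Q"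
    using ev_conj[of P Q] by simp
qed

lemma ev_True: "ev (\<lambda>n. True)"
  using ev_ge[of 0] by (rule ev_mono) simp

lemma ev_const: "ev (\<lambda>n. P) \<longleftrightarrow> P"
  using ev_True ev_not[of "\<lambda>n. True"] by (cases P) auto

lemma ev_iff: "ev (\<lambda>n. P n \<longleftrightarrow> Q n) \<Longrightarrow> ev P \<longleftrightarrow> ev Q"
  using ev_mono[of "\<lambda>n. (P n \<longleftrightarrow> Q n) \<and> P n" Q] ev_mono[of "\<lambda>n. (P n \<longleftrightarrow> Q n) \<and> Q n" P]
  by (auto simp: ev_conj)

lemma ev_cong2: "ev R \<Longrightarrow> (\<And>n. R n \<Longrightarrow> P n \<longleftrightarrow> Q n) \<Longrightarrow> ev P \<longleftrightarrow> ev Q"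
  by (rule ev_iff) (rule ev_mono)

end

text \<open>Zorn's lemma yields a family maximal among those whose finite subfamilies have infinite
  intersection. Demanding infinite rather than nonempty intersections keeps all finite sets out, so
  the resulting ultrafilter is free.\<close>

lemma free_ultrafilter_exists: "\<exists>ev. free_ultrafilter ev"
proof -
  define fip :: "nat set set \<Rightarrow> bool"
    where "fip W \<longleftrightarrow> (\<forall>Y\<subseteq>W. finite Y \<longrightarrow> infinite (\<Inter>Y))" for W
  have "\<exists>W\<in>Collect fip. \<forall>V\<in>Collect fip. W \<subseteq> V \<longrightarrow> V = W"
  proof (rule subset_Zorn_nonempty)
    have "fip {}"
      by (simp add: fip_def)
    then show "Collect fip \<noteq> {}"
      by blast
  next
    fix C
    assume C: "C \<noteq> {}" "subset.chain (Collect fip) C"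
    have "infinite (\<Inter>Y)" if Y: "Y \<subseteq> \<Union>C" "finite Y" for Y
    proof -
      obtain W where "W \<in> C" "Y \<subseteq> W"
        using finite_subset_Union_chain[OF Y(2) Y(1) C(1,2)] by auto
      then show ?thesis
        using C(2) Y(2) by (auto simp: subset.chain_def fip_def)
    qed
    then show "\<Union>C \<in> Collect fip"
      by (simp add: fip_def)
  qed
  then obtain W where W: "fip W" and max: "\<And>V. fip V \<Longrightarrow> W \<subseteq> V \<Longrightarrow> V = W"
    by blast
  \<comment> \<open>Maximality in usable form: a set that meets every finite intersection from
    \<open>W\<close> in an infinite set can be adjoined, so it belongs to \<open>W\<close>
    already.\<close>
  have memI: "A \<in> W" if "\<And>Y. Y \<subseteq> W \<Longrightarrow> finite Y \<Longrightarrow> infinite (A \<inter> \<Inter>Y)" for A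
  proof -
    have "fip (insert A W)"
      unfolding fip_def
    proof (intro allI impI)
      fix Y
      assume "Y \<subseteq> insert A W" "finite Y"
      then have "infinite (A \<inter> \<Inter>(Y - {A}))"
        by (intro that) auto
      then show "infinite (\<Inter>Y)"
        by (rule contrapos_nn) (auto elim: rev_finite_subset)
    qed
    from max[OF this] show ?thesis
      by blast
  qed
  \<comment> \<open>If \<open>A\<close> cannot be adjoined, some finite \<open>Z\<close> makes
    \<open>A \<inter> \<Inter>Z\<close> finite, so all but finitely many points of any intersection
    below \<open>\<Inter>Z\<close> lie in \<open>- A\<close>.\<close>
  have notin: "- A \<in> W" if A: "A \<notin> W" for A
  proof (rule memI)
    fix Y
    assume Y: "Y \<subseteq> W" "finite Y"
    obtain Z where Z: "Z \<subseteq> W" "finite Z" "finite (A \<inter> \<Inter>Z)"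
      using memI A by blast
    have "infinite (\<Inter>(Y \<union> Z))"
      using W Y Z by (auto simp: fip_def)
    moreover have "\<Inter>(Y \<union> Z) \<subseteq> (- A \<inter> \<Inter>Y) \<union> (A \<inter> \<Inter>Z)"
      by auto
    ultimately show "infinite (- A \<inter> \<Inter>Y)"
      using Z(3) by (meson finite_UnI finite_subset)
  qed
  have inter: "A \<inter> B \<in> W" if "A \<in> W" "B \<in> W" for A B
  proof (rule memI)
    fix Y
    assume Y: "Y \<subseteq> W" "finite Y"
    have "insert A (insert B Y) \<subseteq> W" "finite (insert A (insert B Y))"
      using Y that by auto
    then have "infinite (\<Inter>(insert A (insert B Y)))"
      using W unfolding fip_def by blast
    then show "infinite (A \<inter> B \<inter> \<Inter>Y)"
      by (simp add: Int_assoc)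
  qed
  have inf: "infinite A" if "A \<in> W" for A
    using W[unfolded fip_def, rule_format, of "{A}"] that by simp
  have up: "B \<in> W" if "A \<in> W" "A \<subseteq> B" for A B
  proof (rule ccontr)
    assume "B \<notin> W"
    then have "infinite (A \<inter> - B)"
      using inf inter notin that(1) by blast
    then show False
      using that(2) by (simp add: Diff_eq[symmetric] Diff_eq_empty_iff[THEN iffD2])
  qed
  have compl: "- A \<in> W \<longleftrightarrow> A \<notin> W" for A
    using notin inter[of A "- A"] inf[of "{}"] by auto
  have "free_ultrafilter (\<lambda>P. Collect P \<in> W)"
  proof
    fix P Q :: "nat \<Rightarrow> bool" and k :: nat
    show "{n. \<not> P n} \<in> W \<longleftrightarrow> {n. P n} \<notin> W"
      using compl[of "Collect P"] by (simp add: Collect_neg_eq)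
    show "{n. P n \<and> Q n} \<in> W \<longleftrightarrow> {n. P n} \<in> W \<and> {n. Q n} \<in> W"
      using inter up by (auto simp: Collect_conj_eq)
    show "{n. k \<le> n} \<in> W"
      using inf[of "{..<k}"] compl[of "{..<k}"] by (auto simp: Compl_eq not_less)
  qed
  then show ?thesis
    by blast
qed

section \<open>Satisfaction, ultrapowers and the theorem of Los\<close>

lemma sat_cong: "(\<And>i. i \<in> free_vars p \<Longrightarrow> e i = e' i) \<Longrightarrow> sat M e p \<longleftrightarrow> sat M e' p"
proof (induction p arbitrary: e e')
  have term_val: "term_val M e t = term_val M e' t" if "\<And>i. i \<in> term_vars t \<Longrightarrow> e i = e' i"
    for e e' and t :: "'a fterm"
    using that
  proof (induction t)
    case (App g ts)
    then have "map (term_val M e) ts = map (term_val M e') ts"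
      by (intro map_cong) auto
    then show ?case
      by (simp only: term_val.simps)
  qed simp
  {
    case (Eq s t)
    then show ?case
      using term_val[of s e e'] term_val[of t e e'] by simp
  next
    case (Rel r ts)
    then have "map (term_val M e) ts = map (term_val M e') ts"
      by (intro map_cong refl term_val) auto
    then show ?case
      by (simp only: sat.simps)
  }
next
  case (Neg p)
  from Neg.IH[of e e'] Neg.prems show ?case by simp
next
  case (Conj p q)
  from Conj.IH(1)[of e e'] Conj.IH(2)[of e e'] Conj.prems show ?case by auto
next
  case (Ex i p)
  then have "sat M (e(i := a)) p \<longleftrightarrow> sat M (e'(i := a)) p" for a
    by (intro Ex.IH) auto
  then show ?case
    by simp
qed

text \<open>The class of a sequence is represented by the set of all equivalent sequences, so that the
  ultrapower of a structure on \<open>'a\<close> has its universe in \<open>('a, 'f, 'r) large\<close>.\<close>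

context free_ultrafilter
begin

definition cls :: "(nat \<Rightarrow> 'a) \<Rightarrow> ('a, 'f, 'r) large" where
  "cls s = {\<lambda>n. Inl (t n) | t. ev (\<lambda>n. s n = t n)}"

definition rep :: "('a, 'f, 'r) large \<Rightarrow> nat \<Rightarrow> 'a" where
  "rep c = (SOME s. cls s = c)"

definition ultrapower ::
  "('h, 'q, 'a) struct \<Rightarrow> ('h, 'q, ('a, 'f, 'r) large) struct" where
  "ultrapower M =
     \<lparr>univ = range cls,
      fun_interp = \<lambda>g cs. cls (\<lambda>n. fun_interp M g (map (\<lambda>c. rep c n) cs)),
      rel_interp = \<lambda>r cs. ev (\<lambda>n. rel_interp M r (map (\<lambda>c. rep c n) cs))\<rparr>"

lemma cls_eq_iff: "cls s = cls t \<longleftrightarrow> ev (\<lambda>n. s n = t n)"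
proof
  assume "cls s = (cls t :: ('a, 'f, 'r) large)"
  moreover have "(\<lambda>n. Inl (t n)) \<in> (cls t :: ('a, 'f, 'r) large)"
    by (auto simp: cls_def ev_const)
  ultimately obtain t' where "(\<lambda>n. Inl (t n)) = (\<lambda>n. Inl (t' n) :: 'a + 'f + 'r)" "ev (\<lambda>n. s n = t' n)"
    by (auto simp: cls_def)
  then show "ev (\<lambda>n. s n = t n)"
    by (auto simp: fun_eq_iff)
next
  assume "ev (\<lambda>n. s n = t n)"
  then have "ev (\<lambda>n. s n = u n) \<longleftrightarrow> ev (\<lambda>n. t n = u n)" for u
    by (rule ev_cong2) simp
  then show "cls s = cls t"
    by (simp add: cls_def)
qed

lemma ev_rep_cls: "ev (\<lambda>n. rep (cls s) n = s n)"
  (is "ev (\<lambda>n. rep ?c n = s n)")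
proof -
  have "cls (rep ?c) = ?c"
    unfolding rep_def by (rule someI[where P = "\<lambda>t. cls t = ?c"]) (rule refl)
  then show ?thesis
    by (simp only: cls_eq_iff)
qed

lemma ev_reps_cls: "ev (\<lambda>n. map (\<lambda>c. rep c n) (map cls ss) = map (\<lambda>s. s n) ss)"
proof (induction ss)
  case (Cons s ss)
  then show ?case
    using ev_rep_cls[of s] by (simp add: ev_conj)
qed (simp add: ev_True)

text \<open>The interpretation uses the representatives chosen by \<open>rep\<close>. They agree
  with any given ones at almost all indices, so the choice does not matter.\<close>

lemma fun_interp_cls:
  "fun_interp (ultrapower M) g (map cls ss) = cls (\<lambda>n. fun_interp M g (map (\<lambda>s. s n) ss))"
  (is "fun_interp _ g ?cs = _")
proof -
  have "ev (\<lambda>n. map (\<lambda>c. rep c n) ?cs = map (\<lambda>s. s n) ss)"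
    by (rule ev_reps_cls)
  then show ?thesis
    unfolding ultrapower_def struct.simps cls_eq_iff by (rule ev_mono) (simp only:)
qed

lemma rel_interp_cls:
  "rel_interp (ultrapower M) r (map cls ss) \<longleftrightarrow> ev (\<lambda>n. rel_interp M r (map (\<lambda>s. s n) ss))"
  (is "rel_interp _ r ?cs \<longleftrightarrow> _")
proof -
  have "ev (\<lambda>n. map (\<lambda>c. rep c n) ?cs = map (\<lambda>s. s n) ss)"
    by (rule ev_reps_cls)
  then show ?thesis
    unfolding ultrapower_def struct.simps by (rule ev_cong2) (simp only:)
qed

lemma univ_ultrapower: "univ (ultrapower M) = range cls"
  by (simp add: ultrapower_def)

lemma term_val_cls:
  "term_val (ultrapower M) (\<lambda>i. cls (s i)) t = cls (\<lambda>n. term_val M (\<lambda>i. s i n) t)"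
  (is "term_val ?N _ _ = _")
proof (induction t)
  case (App g ts)
  then have "map (term_val ?N (\<lambda>i. cls (s i))) ts =
      map cls (map (\<lambda>t n. term_val M (\<lambda>i. s i n) t) ts)"
    by simp
  then show ?case
    by (simp only: term_val.simps fun_interp_cls) (simp add: comp_def)
qed simp

theorem Los:
  assumes "univ M = UNIV"
  shows "sat (ultrapower M) (\<lambda>i. cls (s i)) p \<longleftrightarrow> ev (\<lambda>n. sat M (\<lambda>i. s i n) p)"
    (is "sat ?N _ _ \<longleftrightarrow> _")
proof (induction p arbitrary: s)
  case (Eq t u)
  then show ?case
    by (simp add: term_val_cls cls_eq_iff)
next
  case (Rel r ts)
  have "map (term_val ?N (\<lambda>i. cls (s i))) ts =
      map cls (map (\<lambda>t n. term_val M (\<lambda>i. s i n) t) ts)"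
    by (simp add: term_val_cls)
  then show ?case
    by (simp only: sat.simps rel_interp_cls) (simp add: comp_def)
next
  case (Neg p)
  then show ?case
    by (simp add: ev_not)
next
  case (Conj p q)
  then show ?case
    by (simp add: ev_conj)
next
  case (Ex i p)
  have "sat ?N ((\<lambda>j. cls (s j))(i := cls a)) p \<longleftrightarrow>
      ev (\<lambda>n. sat M (\<lambda>j. (s(i := a)) j n) p)" for a
    unfolding Ex.IH[symmetric] by (rule arg_cong[where f = "\<lambda>e. sat ?N e p"]) (simp add: fun_eq_iff)
  then have "sat ?N (\<lambda>i. cls (s i)) (Ex i p) \<longleftrightarrow>
      (\<exists>a. ev (\<lambda>n. sat M (\<lambda>j. (s(i := a)) j n) p))"
    by (simp add: univ_ultrapower)
  also have "\<dots> \<longleftrightarrow> ev (\<lambda>n. \<exists>a. sat M ((\<lambda>j. s j n)(i := a)) p)"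
  proof
    assume "\<exists>a. ev (\<lambda>n. sat M (\<lambda>j. (s(i := a)) j n) p)"
    then obtain a where "ev (\<lambda>n. sat M (\<lambda>j. (s(i := a)) j n) p)" ..
    then show "ev (\<lambda>n. \<exists>a. sat M ((\<lambda>j. s j n)(i := a)) p)"
    proof (rule ev_mono)
      fix n
      have "(\<lambda>j. (s(i := a)) j n) = (\<lambda>j. s j n)(i := a n)"
        by auto
      then show "sat M (\<lambda>j. (s(i := a)) j n) p \<Longrightarrow> \<exists>a. sat M ((\<lambda>j. s j n)(i := a)) p"
        by auto
    qed
  next
    assume *: "ev (\<lambda>n. \<exists>a. sat M ((\<lambda>j. s j n)(i := a)) p)"
    \<comment> \<open>Witnesses are chosen index by index. At the negligible indices without a
      witness the value is arbitrary.\<close>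
    define a where "a n = (SOME a. sat M ((\<lambda>j. s j n)(i := a)) p)" for n
    from * have "ev (\<lambda>n. sat M ((\<lambda>j. s j n)(i := a n)) p)"
      by (rule ev_mono) (auto simp: a_def intro: someI)
    then have "ev (\<lambda>n. sat M (\<lambda>j. (s(i := a)) j n) p)"
    proof (rule ev_mono)
      fix n
      have "(\<lambda>j. (s(i := a)) j n) = (\<lambda>j. s j n)(i := a n)"
        by auto
      then show "sat M ((\<lambda>j. s j n)(i := a n)) p \<Longrightarrow> sat M (\<lambda>j. (s(i := a)) j n) p"
        by simp
    qed
    then show "\<exists>a. ev (\<lambda>n. sat M (\<lambda>j. (s(i := a)) j n) p)"
      by (rule exI[of _ a])
  qed
  finally show ?case
    using assms by simp
qed

text \<open>A sentence does not depend on the assignment, so it may be evaluated at classes of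
  constant sequences, where the theorem of Los reduces it to its truth in \<open>M\<close>.\<close>

lemma elem_equiv_ultrapower:
  assumes "univ M = UNIV"
  shows "elem_equiv L M (ultrapower M)"
    (is "elem_equiv _ _ ?N")
  unfolding elem_equiv_def
proof (intro allI impI)
  fix p
  assume p: "form_in L p \<and> free_vars p = {}"
  define e0 :: "nat \<Rightarrow> 'a" where "e0 = undefined"
  have M: "sat M e p \<longleftrightarrow> sat M e0 p" for e
    using p by (intro sat_cong) auto
  have "sat ?N e p \<longleftrightarrow> sat ?N (\<lambda>i. cls (\<lambda>n. e0 i)) p" for e
    using p by (intro sat_cong) auto
  then have N: "sat ?N e p \<longleftrightarrow> sat M e0 p" for e
    unfolding Los[OF assms] ev_const .
  have "range (\<lambda>i. cls (\<lambda>n. e0 i)) \<subseteq> univ ?N"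
    by (auto simp: univ_ultrapower)
  then show "(\<forall>e. range e \<subseteq> univ M \<longrightarrow> sat M e p) \<longleftrightarrow>
      (\<forall>e. range e \<subseteq> univ ?N \<longrightarrow> sat ?N e p)"
    using assms M N by (metis subset_UNIV)
qed

lemma is_struct_ultrapower: "is_struct L (ultrapower M)"
  by (auto simp: is_struct_def ultrapower_def)

end

section \<open>Definable predicates on environments\<close>

primrec rename_term :: "(nat \<Rightarrow> nat) \<Rightarrow> 'f fterm \<Rightarrow> 'f fterm" where
  "rename_term \<rho> (Var i) = Var (\<rho> i)"
| "rename_term \<rho> (App g ts) = App g (map (rename_term \<rho>) ts)"

primrec rename_form :: "(nat \<Rightarrow> nat) \<Rightarrow> ('f, 'r) form \<Rightarrow> ('f, 'r) form" where
  "rename_form \<rho> (Eq s t) = Eq (rename_term \<rho> s) (rename_term \<rho> t)"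
| "rename_form \<rho> (Rel r ts) = Rel r (map (rename_term \<rho>) ts)"
| "rename_form \<rho> (Neg p) = Neg (rename_form \<rho> p)"
| "rename_form \<rho> (Conj p q) = Conj (rename_form \<rho> p) (rename_form \<rho> q)"
| "rename_form \<rho> (Ex i p) = Ex (\<rho> i) (rename_form \<rho> p)"

primrec all_vars :: "('f, 'r) form \<Rightarrow> nat set" where
  "all_vars (Eq s t) = term_vars s \<union> term_vars t"
| "all_vars (Rel r ts) = \<Union> (set (map term_vars ts))"
| "all_vars (Neg p) = all_vars p"
| "all_vars (Conj p q) = all_vars p \<union> all_vars q"
| "all_vars (Ex i p) = insert i (all_vars p)"

lemma finite_term_vars: "finite (term_vars t)"
  by (induction t) auto

lemma finite_all_vars: "finite (all_vars p)"
  by (induction p) (auto simp: finite_term_vars)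

lemma term_in_rename: "term_in L (rename_term \<rho> t) \<longleftrightarrow> term_in L t"
  by (induction t) (auto simp: list_all_iff)

lemma form_in_rename: "form_in L (rename_form \<rho> p) \<longleftrightarrow> form_in L p"
  by (induction p) (auto simp: list_all_iff term_in_rename)

lemma term_val_rename:
  "(\<And>i. i \<in> term_vars t \<Longrightarrow> e (\<rho> i) = e' i) \<Longrightarrow> term_val M e (rename_term \<rho> t) = term_val M e' t"
proof (induction t)
  case (App g ts)
  then have "map (term_val M e \<circ> rename_term \<rho>) ts = map (term_val M e') ts"
    by (intro map_cong refl) auto
  then show ?case
    by (simp only: term_val.simps rename_term.simps list.map_comp)
qed simp

text \<open>Bound variables are renamed as well. Injectivity on all variables, bound ones included,
  is what prevents capture.\<close>

lemma sat_rename: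
  assumes "inj_on \<rho> (all_vars p)" "\<And>i. i \<in> all_vars p \<Longrightarrow> e (\<rho> i) = e' i"
  shows "sat M e (rename_form \<rho> p) \<longleftrightarrow> sat M e' p"
  using assms
proof (induction p arbitrary: e e')
  case (Eq s t)
  then show ?case
    using term_val_rename[of s e \<rho> e' M] term_val_rename[of t e \<rho> e' M] by simp
next
  case (Rel r ts)
  then have "map (term_val M e \<circ> rename_term \<rho>) ts = map (term_val M e') ts"
    by (intro map_cong refl) (auto intro!: term_val_rename)
  then show ?case
    by (simp only: sat.simps rename_form.simps list.map_comp)
next
  case (Neg p)
  from Neg.IH[of e e'] Neg.prems show ?case by simp
next
  case (Conj p q)
  from Conj.IH(1)[of e e'] Conj.IH(2)[of e e'] Conj.prems show ?case
    by (auto simp: inj_on_Un)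
next
  case (Ex i p)
  have inj: "inj_on \<rho> (all_vars p)"
    using Ex.prems(1) by (auto simp: inj_on_def)
  have "sat M (e(\<rho> i := a)) (rename_form \<rho> p) \<longleftrightarrow> sat M (e'(i := a)) p" for a
    using Ex.prems by (intro Ex.IH inj) (auto simp: inj_on_def)
  then show ?case
    by simp
qed

text \<open>The even variables carry the environment and the odd ones the parameters.\<close>

definition mix :: "(nat \<Rightarrow> 'a) \<Rightarrow> (nat \<Rightarrow> 'a) \<Rightarrow> nat \<Rightarrow> 'a" where
  "mix e c i = (if even i then e (i div 2) else c (i div 2))"

lemma mix_simps [simp]: "mix e c 0 = e 0" "mix e c (2 * i) = e i" "mix e c (Suc (2 * i)) = c i"
  by (simp_all add: mix_def)

section \<open>Closure properties of definable predicates\<close>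

locale full_structure =
  fixes L :: "('f, 'r) language" and M :: "('f, 'r, 'a) struct"
  assumes univ: "univ M = UNIV"
begin

text \<open>Definability is attached to a HOL predicate on environments, with formula and parameters
  hidden under the existential quantifier. Closure rules can then follow the shape of the predicate,
  and no formula has to be written down.\<close>

definition def_pred :: "((nat \<Rightarrow> 'a) \<Rightarrow> bool) \<Rightarrow> bool" where
  "def_pred P \<longleftrightarrow> (\<exists>p c. form_in L p \<and> (\<forall>e. sat M (mix e c) p \<longleftrightarrow> P e))"

definition def_term :: "((nat \<Rightarrow> 'a) \<Rightarrow> 'a) \<Rightarrow> bool" where
  "def_term f \<longleftrightarrow> (\<exists>t c. term_in L t \<and> (\<forall>e. term_val M (mix e c) t = f e))"

lemma def_term_var: "def_term (\<lambda>e. e i)"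
  unfolding def_term_def by (rule exI[of _ "Var (2 * i)"]) simp

lemma def_term_const: "def_term (\<lambda>e. a)"
  unfolding def_term_def by (rule exI[of _ "Var 1"]) (auto simp: mix_def intro: exI[of _ "\<lambda>_. a"])

text \<open>A common parameter sequence for two definitions is again obtained by interleaving.\<close>

definition left :: "nat \<Rightarrow> nat" where
  "left i = (if even i then i else Suc (2 * (i - 1)))"

definition right :: "nat \<Rightarrow> nat" where
  "right i = (if even i then i else Suc (2 * i))"

lemma mix_left: "mix e (mix c d) (left i) = mix e c i"
  and mix_right: "mix e (mix c d) (right i) = mix e d i"
  by (cases "even i"; auto simp: mix_def left_def right_def elim!: oddE)+

lemma inj_left: "inj left"
  and inj_right: "inj right"
proof -
  show "inj left"
    by (rule inj_on_inverseI[of _ "\<lambda>j. if even j then j else Suc ((j - 1) div 2)"])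
      (simp add: left_def)
  show "inj right"
    by (rule inj_on_inverseI[of _ "\<lambda>j. if even j then j else (j - 1) div 2"])
      (simp add: right_def)
qed

lemma def_term_pair:
  assumes "def_term f" "def_term g"
  obtains s t c where "term_in L s" "\<And>e. term_val M (mix e c) s = f e"
    "term_in L t" "\<And>e. term_val M (mix e c) t = g e"
proof -
  obtain s c t d where st: "term_in L s" "\<And>e. term_val M (mix e c) s = f e"
    "term_in L t" "\<And>e. term_val M (mix e d) t = g e"
    using assms unfolding def_term_def by blast
  show ?thesis
  proof (rule that)
    show "term_in L (rename_term left s)" "term_in L (rename_term right t)"
      using st by (simp_all add: term_in_rename)
    show "term_val M (mix e (mix c d)) (rename_term left s) = f e" for e
      using st term_val_rename[of s _ left "mix e c"] mix_left by metis
    show "term_val M (mix e (mix c d)) (rename_term right t) = g e" for e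
      using st term_val_rename[of t _ right "mix e d"] mix_right by metis
  qed
qed

lemma def_term_App2:
  assumes "(h, 2) \<in> fun_syms L" "def_term f" "def_term g"
  shows "def_term (\<lambda>e. fun_interp M h [f e, g e])"
proof -
  obtain s t c where "term_in L s" "\<And>e. term_val M (mix e c) s = f e"
    "term_in L t" "\<And>e. term_val M (mix e c) t = g e"
    using def_term_pair[OF assms(2,3)] by metis
  then show ?thesis
    unfolding def_term_def using assms(1)
    by (intro exI[of _ "App h [s, t]"] exI[of _ c]) (simp add: eval_nat_numeral)
qed

lemma def_pred_Rel2:
  assumes "(r, 2) \<in> rel_syms L" "def_term f" "def_term g"
  shows "def_pred (\<lambda>e. rel_interp M r [f e, g e])"
proof -
  obtain s t c where "term_in L s" "\<And>e. term_val M (mix e c) s = f e"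
    "term_in L t" "\<And>e. term_val M (mix e c) t = g e"
    using def_term_pair[OF assms(2,3)] by metis
  then show ?thesis
    unfolding def_pred_def using assms(1)
    by (intro exI[of _ "Rel r [s, t]"] exI[of _ c]) (simp add: eval_nat_numeral)
qed

lemma def_pred_eq:
  assumes "def_term f" "def_term g"
  shows "def_pred (\<lambda>e. f e = g e)"
proof -
  obtain s t c where "term_in L s" "\<And>e. term_val M (mix e c) s = f e"
    "term_in L t" "\<And>e. term_val M (mix e c) t = g e"
    using def_term_pair[OF assms] by metis
  then show ?thesis
    unfolding def_pred_def by (intro exI[of _ "Eq s t"] exI[of _ c]) simp
qed

lemma def_pred_not:
  assumes "def_pred P"
  shows "def_pred (\<lambda>e. \<not> P e)"
proof -
  obtain p c where "form_in L p" "\<And>e. sat M (mix e c) p \<longleftrightarrow> P e"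
    using assms unfolding def_pred_def by blast
  then show ?thesis
    unfolding def_pred_def by (intro exI[of _ "Neg p"] exI[of _ c]) simp
qed

lemma def_pred_conj:
  assumes "def_pred P" "def_pred Q"
  shows "def_pred (\<lambda>e. P e \<and> Q e)"
proof -
  obtain p c q d where pq: "form_in L p" "\<And>e. sat M (mix e c) p \<longleftrightarrow> P e"
    "form_in L q" "\<And>e. sat M (mix e d) q \<longleftrightarrow> Q e"
    using assms unfolding def_pred_def by blast
  have inj: "inj_on left A" "inj_on right A" for A
    using inj_left inj_right by (auto intro: inj_on_subset)
  have "sat M (mix e (mix c d)) (rename_form left p) \<longleftrightarrow> P e"
    "sat M (mix e (mix c d)) (rename_form right q) \<longleftrightarrow> Q e" for e
    using pq sat_rename[OF inj(1), of p _ "mix e c"] sat_rename[OF inj(2), of q _ "mix e d"]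
      mix_left mix_right by metis+
  then show ?thesis
    unfolding def_pred_def using pq(1,3)
    by (intro exI[of _ "Conj (rename_form left p) (rename_form right q)"] exI[of _ "mix c d"])
      (simp add: form_in_rename)
qed

lemma def_pred_imp: "def_pred P \<Longrightarrow> def_pred Q \<Longrightarrow> def_pred (\<lambda>e. P e \<longrightarrow> Q e)"
  using def_pred_not[OF def_pred_conj[OF _ def_pred_not, of P Q]] by simp

text \<open>Environments are read as de Bruijn stacks.\<close>

lemma def_pred_ex:
  assumes "def_pred (\<lambda>e. P (e 0) (\<lambda>n. e (Suc n)))"
  shows "def_pred (\<lambda>e. \<exists>a. P a e)"
proof -
  obtain p c where p: "form_in L p" "\<And>e. sat M (mix e c) p \<longleftrightarrow> P (e 0) (\<lambda>n. e (Suc n))"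
    using assms unfolding def_pred_def by blast
  \<comment> \<open>A fresh even index beyond all variables of \<open>p\<close>, to serve as the
    bound variable.\<close>
  define j where "j = 2 * Suc (Max (insert 0 (all_vars p)))"
  have j: "i < j" if "i \<in> all_vars p" for i
  proof -
    have "i \<le> Max (insert 0 (all_vars p))"
      using that finite_all_vars by (intro Max_ge) auto
    then show ?thesis
      unfolding j_def by (rule le_less_trans) (simp del: Max_insert)
  qed
  have even_j: "even j"
    by (simp add: j_def)
  \<comment> \<open>The top of the stack becomes the bound variable, the other environment slots
    move down by one (two indices), and the odd parameter variables stay.\<close>
  define \<rho> where "\<rho> i = (if i = 0 then j else if even i then i - 2 else i)" for i
  have inj: "inj_on \<rho> (all_vars p)"
    by (rule inj_on_inverseI[of _ "\<lambda>i. if i = j then 0 else if even i then i + 2 else i"])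
      (use j even_j in \<open>fastforce simp: \<rho>_def elim: evenE\<close>)
  have "sat M ((mix e c)(j := a)) (rename_form \<rho> p) \<longleftrightarrow> P a e" for a e
  proof -
    have "((mix e c)(j := a)) (\<rho> i) = mix (case_nat a e) c i" if "i \<in> all_vars p" for i
      using j[OF that] even_j
      by (cases "even i") (auto simp: \<rho>_def mix_def elim!: evenE split: nat.split)
    then have "sat M ((mix e c)(j := a)) (rename_form \<rho> p) \<longleftrightarrow> sat M (mix (case_nat a e) c) p"
      using inj by (intro sat_rename)
    then show ?thesis
      by (simp add: p(2))
  qed
  then show ?thesis
    unfolding def_pred_def using p(1) univ
    by (intro exI[of _ "Ex j (rename_form \<rho> p)"] exI[of _ c]) (simp add: form_in_rename)
qed

lemma def_pred_all:
  "def_pred (\<lambda>e. P (e 0) (\<lambda>n. e (Suc n))) \<Longrightarrow> def_pred (\<lambda>e. \<forall>a. P a e)"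
  using def_pred_not[OF def_pred_ex, of "\<lambda>a e. \<not> P a e"] def_pred_not by simp

lemma def_term_shift:
  assumes "def_term f"
  shows "def_term (\<lambda>e. f (\<lambda>n. e (Suc n)))"
proof -
  obtain t c where t: "term_in L t" "\<And>e. term_val M (mix e c) t = f e"
    using assms unfolding def_term_def by blast
  define \<rho> where "\<rho> i = (if even i then i + 2 else i)" for i :: nat
  have "term_val M (mix e c) (rename_term \<rho> t) = term_val M (mix (\<lambda>n. e (Suc n)) c) t" for e
    by (rule term_val_rename) (auto simp: \<rho>_def mix_def)
  then show ?thesis
    unfolding def_term_def using t
    by (intro exI[of _ "rename_term \<rho> t"] exI[of _ c]) (simp add: term_in_rename)
qed

text \<open>Terms are substituted by quantifying over their values, so formulas need no substitution
  operation. The argument bound last sits in slot 0, hence \<open>G (e 1) (e 0)\<close>.\<close>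

lemma def_pred_subst2:
  assumes "def_pred (\<lambda>e. G (e 1) (e 0))" "def_term f" "def_term g"
  shows "def_pred (\<lambda>e. G (f e) (g e))"
proof -
  have "def_pred (\<lambda>e. \<exists>x. x = f e \<and> (\<exists>y. y = g e \<and> G x y))"
    using assms
    by (intro def_pred_ex def_pred_conj def_pred_eq def_term_var def_term_shift) simp_all
  then show ?thesis
    by simp
qed

lemma definable_2_imp_def_pred:
  assumes "definable L M 2 {[x, y] | x y. G x y}"
  shows "def_pred (\<lambda>e. G (e 1) (e 0))"
proof -
  obtain p c where p: "form_in L p"
    "{[x, y] | x y. G x y} = {xs \<in> tuples M 2. sat M (\<lambda>i. if i < 2 then xs ! i else c i) p}"
    using assms unfolding definable_def by blast
  \<comment> \<open>Coordinates 0 and 1 go to the environment slots 1 and 0, which are the variables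
    2 and 0. All other variables are parameters and become odd.\<close>
  define \<rho> where "\<rho> i = (if i = 0 then 2 else if i = 1 then 0 else Suc (2 * i))" for i :: nat
  have "inj \<rho>"
    by (auto simp: inj_def \<rho>_def split: if_splits)
  then have inj: "inj_on \<rho> A" for A
    by (rule inj_on_subset) simp
  have "sat M (mix e c) (rename_form \<rho> p) \<longleftrightarrow> G (e 1) (e 0)" for e
  proof -
    have "sat M (mix e c) (rename_form \<rho> p) \<longleftrightarrow> sat M (\<lambda>i. if i < 2 then [e 1, e 0] ! i else c i) p"
      by (rule sat_rename[OF inj]) (auto simp: \<rho>_def mix_def nth_Cons split: nat.split)
    also have "\<dots> \<longleftrightarrow> [e 1, e 0] \<in> {[x, y] | x y. G x y}"
      unfolding p(2) by (simp add: tuples_def univ cong: if_cong)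
    finally show ?thesis
      by simp
  qed
  then show ?thesis
    unfolding def_pred_def using p(1)
    by (intro exI[of _ "rename_form \<rho> p"] exI[of _ c]) (simp add: form_in_rename)
qed

lemma def_pred_imp_definable_3:
  assumes "def_pred (\<lambda>e. Q (e 0) (e 1) (e 2))"
  shows "definable L M 3 {[x, y, z] | x y z. Q x y z}"
proof -
  obtain p c where p: "form_in L p" "\<And>e. sat M (mix e c) p \<longleftrightarrow> Q (e 0) (e 1) (e 2)"
    using assms unfolding def_pred_def by blast
  \<comment> \<open>Slots 0, 1, 2 become the three coordinates and every other variable moves up by
    3 into the parameters. The remaining slots are filled from \<open>c\<close>, which is harmless
    because \<open>Q\<close> reads only the first three.\<close>
  define \<rho> where "\<rho> i = (if even i \<and> i < 6 then i div 2 else i + 3)" for i :: nat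
  have "inj \<rho>"
    by (auto simp: inj_def \<rho>_def split: if_splits elim!: evenE)
  then have inj: "inj_on \<rho> A" for A
    by (rule inj_on_subset) simp
  have "sat M (\<lambda>i. if i < 3 then xs ! i else mix c c (i - 3)) (rename_form \<rho> p) \<longleftrightarrow>
      Q (xs ! 0) (xs ! 1) (xs ! 2)" for xs
  proof -
    have "sat M (\<lambda>i. if i < 3 then xs ! i else mix c c (i - 3)) (rename_form \<rho> p) \<longleftrightarrow>
        sat M (mix (\<lambda>i. if i < 3 then xs ! i else c i) c) p"
      by (rule sat_rename[OF inj]) (auto simp: \<rho>_def mix_def)
    then show ?thesis
      unfolding p(2) by simp
  qed
  moreover have "{[x, y, z] | x y z. Q x y z} = {xs \<in> tuples M 3. Q (xs ! 0) (xs ! 1) (xs ! 2)}"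
    by (auto simp: tuples_def univ length_Suc_conv eval_nat_numeral)
  ultimately show ?thesis
    unfolding definable_def using p(1) univ
    by (intro exI[of _ "rename_form \<rho> p"] exI[of _ "\<lambda>i. mix c c (i - 3)"])
      (auto simp: form_in_rename)
qed

end

section \<open>Balls in valued fields\<close>

locale valued_field =
  fixes v :: "'a::field \<Rightarrow> 'g::linordered_ab_group_add extended"
  assumes nontrivial: "nontrivial_valuation v"
begin

lemma v_eq_Pinf_iff: "v x = Pinf \<longleftrightarrow> x = 0"
  and v_neq_Minf: "v x \<noteq> Minf"
  and v_mult: "v (x * y) = v x + v y"
  and v_add: "min (v x) (v y) \<le> v (x + y)"
  and v_surj: "\<exists>x. v x = Fin \<gamma>"
  using nontrivial by (auto simp: nontrivial_valuation_def valuation_def)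

lemma v_0 [simp]: "v 0 = Pinf"
  by (simp add: v_eq_Pinf_iff)

lemma v_Fin: "x \<noteq> 0 \<Longrightarrow> \<exists>\<gamma>. v x = Fin \<gamma>"
  using v_eq_Pinf_iff v_neq_Minf by (cases "v x") auto

lemma v_less_Pinf_iff: "v x < Pinf \<longleftrightarrow> x \<noteq> 0"
  by (auto simp: less_le v_eq_Pinf_iff)

lemma v_1 [simp]: "v 1 = Fin 0"
proof -
  obtain \<gamma> where "v 1 = Fin \<gamma>"
    using v_Fin[of 1] by auto
  then show ?thesis
    using v_mult[of 1 1] by simp
qed

lemma v_minus [simp]: "v (- x) = v x"
proof -
  obtain \<gamma> where \<gamma>: "v (- 1) = Fin \<gamma>"
    using v_Fin[of "- 1"] by auto
  then have "\<gamma> + \<gamma> = 0"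
    using v_mult[of "- 1" "- 1"] by simp
  then have "v (- 1) = Fin 0"
    using \<gamma> by simp
  then show ?thesis
    using v_mult[of "- 1" x] by (cases "v x") auto
qed

lemma v_commute: "v (x - y) = v (y - x)"
  using v_minus[of "x - y"] by simp

lemma v_less_trans: "\<gamma> < v (x - y) \<Longrightarrow> \<gamma> < v (y - z) \<Longrightarrow> \<gamma> < v (x - z)"
  using v_add[of "x - y" "y - z"] by (auto simp: min_def split: if_splits)

lemma v_le_trans: "\<gamma> \<le> v (x - y) \<Longrightarrow> \<gamma> \<le> v (y - z) \<Longrightarrow> \<gamma> \<le> v (x - z)"
  using v_add[of "x - y" "y - z"] by (auto simp: min_def split: if_splits)

text \<open>By nontriviality some \<open>u\<close> has nonzero value, so \<open>u\<close> or its
  inverse has positive value; multiplying \<open>c\<close> by it increases the value. Hence no open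
  ball is a point.\<close>

lemma ex_larger_v:
  assumes "c \<noteq> 0"
  shows "\<exists>d. d \<noteq> 0 \<and> v c < v d"
proof -
  obtain u where "u \<noteq> 0" "v u \<noteq> 0"
    using nontrivial by (auto simp: nontrivial_valuation_def)
  moreover have "v (inverse u) = - v u" if u: "u \<noteq> 0" for u
  proof -
    obtain \<gamma> \<delta> where "v u = Fin \<gamma>" "v (inverse u) = Fin \<delta>"
      using v_Fin[of u] v_Fin[of "inverse u"] u by auto
    then show ?thesis
      using v_mult[of u "inverse u"] u by (simp add: eq_neg_iff_add_eq_0 add.commute)
  qed
  ultimately obtain w \<gamma> where w: "w \<noteq> 0" "v w = Fin \<gamma>" "\<gamma> > 0"
    using v_Fin[of u] by (auto simp: zero_extended_def) (metis inverse_zero_imp_zero linorder_neqE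
        neg_0_less_iff_less uminus_extended.simps(1))
  obtain \<delta> where "v c = Fin \<delta>"
    using v_Fin assms by blast
  then have "v c < v (c * w)"
    using w by (simp add: v_mult)
  then show ?thesis
    using assms w(1) by (intro exI[of _ "c * w"]) simp
qed

section \<open>Balls and their finite combinations near a point\<close>

definition is_ball :: "'a set \<Rightarrow> bool" where
  "is_ball B \<longleftrightarrow> is_closed_ball v B \<or> is_open_ball v B"

lemma is_ball_cases:
  assumes "is_ball B"
  obtains (UNIV) "B = UNIV" | (point) a where "B = {a}"
    | (closed) a c where "c \<noteq> 0" "B = {x. v c \<le> v (x - a)}"
    | (opened) a c where "c \<noteq> 0" "B = {x. v c < v (x - a)}"
proof -
  consider a \<gamma> where "\<gamma> \<noteq> Minf" "B = {x. \<gamma> \<le> v (x - a)}"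
    | a \<gamma> where "\<gamma> \<noteq> Pinf" "B = {x. \<gamma> < v (x - a)}"
    using assms unfolding is_ball_def is_closed_ball_def is_open_ball_def by blast
  then show ?thesis
  proof cases
    case (1 a \<gamma>)
    show ?thesis
    proof (cases \<gamma>)
      case (Fin g)
      then obtain c where "v c = \<gamma>"
        using v_surj by metis
      then show ?thesis
        using 1 Fin v_0 by (intro closed[of c a]) auto
    qed (use 1 in \<open>auto simp: v_eq_Pinf_iff intro: point[of a]\<close>)
  next
    case (2 a \<gamma>)
    show ?thesis
    proof (cases \<gamma>)
      case (Fin g)
      then obtain c where "v c = \<gamma>"
        using v_surj by metis
      then show ?thesis
        using 2 Fin v_0 by (intro opened[of c a]) auto
    qed (use 2 v_neq_Minf[symmetric] UNIV in \<open>auto simp: less_le\<close>)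
  qed
qed

lemma is_ball_UNIV: "is_ball UNIV"
  unfolding is_ball_def is_open_ball_def using v_neq_Minf
  by (intro disjI2 exI[of _ "0 :: 'a"] exI[of _ Minf]) (auto simp: less_le dest: sym)

lemma is_ball_closed: "is_ball {x. v c \<le> v (x - a)}"
  unfolding is_ball_def is_closed_ball_def using v_neq_Minf by blast

lemma open_ball_is_open: "c \<noteq> 0 \<Longrightarrow> is_open_ball v {x. v c < v (x - a)}"
  unfolding is_open_ball_def using v_eq_Pinf_iff by blast

lemma open_ball_contains:
  assumes "is_open_ball v B" "x \<in> B"
  shows "\<exists>c. c \<noteq> 0 \<and> {y. v c < v (y - x)} \<subseteq> B"
proof -
  obtain a \<gamma> where B: "\<gamma> \<noteq> Pinf" "B = {y. \<gamma> < v (y - a)}"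
    using assms(1) unfolding is_open_ball_def by blast
  obtain c where "c \<noteq> 0" "\<gamma> \<le> v c"
  proof (cases \<gamma>)
    case (Fin g)
    obtain c where c: "v c = Fin g"
      using v_surj ..
    then have "c \<noteq> 0"
      by auto
    then show ?thesis
      using that[of c] c Fin by simp
  qed (use that[of 1] B in auto)
  then have "{y. v c < v (y - x)} \<subseteq> B"
    unfolding B(2) using assms(2) B(2) v_less_trans[of \<gamma> _ x a] by auto
  with \<open>c \<noteq> 0\<close> show ?thesis
    by blast
qed

text \<open>Every ball other than a point is both open and closed, so it contains or avoids a
  neighbourhood of \<open>x\<close>. Only the ball \<open>{x}\<close> treats \<open>x\<close>
  differently from the points nearby.\<close>

lemma ball_near_point:
  assumes "is_ball B"
  shows "\<exists>c. c \<noteq> 0 \<and> (\<forall>y. y \<noteq> x \<longrightarrow> v c < v (y - x) \<longrightarrow> (y \<in> B \<longleftrightarrow> x \<in> B \<and> B \<noteq> {x}))"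
  using assms
proof (cases rule: is_ball_cases)
  case UNIV
  have "(UNIV :: 'a set) \<noteq> {x}"
    by (metis UNIV_I add_cancel_left_right singletonD zero_neq_one)
  then show ?thesis
    using UNIV by (intro exI[of _ 1]) auto
next
  case (point a)
  show ?thesis
  proof (cases "x = a")
    case True
    then show ?thesis
      using point by (intro exI[of _ 1]) auto
  next
    case False
    then show ?thesis
      using point v_commute[of x a] by (intro exI[of _ "x - a"]) auto
  qed
next
  case (closed a c)
  have "B \<noteq> {x}"
  proof
    assume "B = {x}"
    then have "v c \<le> v (x - a)" "\<not> v c \<le> v (x + c - a)"
      using closed by (auto simp: set_eq_iff)
    then show False
      using v_le_trans[of "v c" "x + c" x a] by simp
  qed
  moreover have "y \<in> B \<longleftrightarrow> x \<in> B" if "v c < v (y - x)" for y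
    using that closed(2) v_le_trans[of "v c" y x a] v_le_trans[of "v c" x y a] v_commute[of x y]
    by auto
  ultimately show ?thesis
    using closed(1) by blast
next
  case (opened a c)
  obtain d where d: "d \<noteq> 0" "v c < v d"
    using ex_larger_v opened(1) by blast
  have "B \<noteq> {x}"
  proof
    assume "B = {x}"
    then have "v c < v (x - a)" "\<not> v c < v (x + d - a)"
      using opened d by (auto simp: set_eq_iff)
    then show False
      using v_less_trans[of "v c" "x + d" x a] d by simp
  qed
  moreover have "y \<in> B \<longleftrightarrow> x \<in> B" if "v c < v (y - x)" for y
    using that opened(2) v_less_trans[of "v c" y x a] v_less_trans[of "v c" x y a] v_commute[of x y]
    by auto
  ultimately show ?thesis
    using opened(1) by blast
qed

lemma ex_common_radius:
  assumes "finite I" "\<And>i. i \<in> I \<Longrightarrow> \<exists>c. c \<noteq> 0 \<and> P i (v c)"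
    "\<And>i \<gamma> \<delta>. i \<in> I \<Longrightarrow> P i \<gamma> \<Longrightarrow> \<gamma> \<le> \<delta> \<Longrightarrow> P i \<delta>"
  shows "\<exists>c. c \<noteq> 0 \<and> (\<forall>i\<in>I. P i (v c))"
  using assms
proof (induction I rule: finite_induct)
  case empty
  then show ?case
    by (intro exI[of _ 1]) simp
next
  case (insert i I)
  then obtain c d where "c \<noteq> 0" "P i (v c)" "d \<noteq> 0" "\<forall>j\<in>I. P j (v d)"
    by (metis insertCI)
  then show ?case
    using insert.prems(2) by (cases "v c \<le> v d") (metis insertE insertI1 insertI2 linear)+
qed

lemma balls_near_point:
  assumes "finite \<B>" "\<And>B. B \<in> \<B> \<Longrightarrow> is_ball B"
  shows "\<exists>c. c \<noteq> 0 \<and> (\<forall>B\<in>\<B>. \<forall>y. y \<noteq> x \<longrightarrow> v c < v (y - x) \<longrightarrow> (y \<in> B \<longleftrightarrow> x \<in> B \<and> B \<noteq> {x}))"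
  by (rule ex_common_radius[where
        P = "\<lambda>B \<gamma>. \<forall>y. y \<noteq> x \<longrightarrow> \<gamma> < v (y - x) \<longrightarrow> (y \<in> B \<longleftrightarrow> x \<in> B \<and> B \<noteq> {x})"])
    (use assms ball_near_point in auto)

text \<open>A semantic form of being a boolean combination of at most \<open>n\<close> balls:
  \<open>S\<close> is a union of cells cut out by the balls. One implication suffices because the
  hypothesis is symmetric in \<open>x\<close> and \<open>y\<close>.\<close>

definition few_balls :: "nat \<Rightarrow> 'a set \<Rightarrow> bool" where
  "few_balls n S \<longleftrightarrow> (\<exists>\<B>. finite \<B> \<and> card \<B> \<le> n \<and> (\<forall>B\<in>\<B>. is_ball B) \<and>
     (\<forall>x y. (\<forall>B\<in>\<B>. x \<in> B \<longleftrightarrow> y \<in> B) \<longrightarrow> x \<in> S \<longrightarrow> y \<in> S))"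

lemma few_ballsI:
  assumes "finite \<B>" "card \<B> \<le> n" "\<And>B. B \<in> \<B> \<Longrightarrow> is_ball B"
    "\<And>x y. \<forall>B\<in>\<B>. x \<in> B \<longleftrightarrow> y \<in> B \<Longrightarrow> x \<in> S \<Longrightarrow> y \<in> S"
  shows "few_balls n S"
  unfolding few_balls_def using assms by (intro exI[of _ \<B>]) simp

text \<open>On a small punctured neighbourhood of \<open>x\<close> no ball of the family separates
  points, so the neighbourhood lies in a single cell.\<close>

lemma few_balls_near_point:
  assumes "few_balls n S"
  shows "\<exists>c. c \<noteq> 0 \<and> ((\<forall>y. y \<noteq> x \<longrightarrow> v c < v (y - x) \<longrightarrow> y \<in> S) \<or>
      (\<forall>y. y \<noteq> x \<longrightarrow> v c < v (y - x) \<longrightarrow> y \<notin> S))"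
proof -
  obtain \<B> where \<B>: "finite \<B>" "\<forall>B\<in>\<B>. is_ball B"
    and sat: "\<And>x y. (\<And>B. B \<in> \<B> \<Longrightarrow> x \<in> B \<longleftrightarrow> y \<in> B) \<Longrightarrow> x \<in> S \<Longrightarrow> y \<in> S"
    using assms unfolding few_balls_def by metis
  obtain c where "c \<noteq> 0"
    and c: "\<And>B y. B \<in> \<B> \<Longrightarrow> y \<noteq> x \<Longrightarrow> v c < v (y - x) \<Longrightarrow> y \<in> B \<longleftrightarrow> x \<in> B \<and> B \<noteq> {x}"
    using balls_near_point[of \<B> x] \<B> by blast
  then have "z \<in> S" if "y \<noteq> x" "v c < v (y - x)" "z \<noteq> x" "v c < v (z - x)" "y \<in> S" for y z
    using sat[OF _ that(5), of z] that by blast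
  with \<open>c \<noteq> 0\<close> show ?thesis
    by blast
qed

text \<open>Only finitely many points are themselves balls of the family. Any other point of
  \<open>S\<close> has a neighbourhood that lies entirely in its own cell.\<close>

lemma few_balls_infinite_interior:
  assumes "few_balls n S" "infinite S"
  shows "\<exists>x\<in>S. \<exists>c. c \<noteq> 0 \<and> (\<forall>y. v c < v (y - x) \<longrightarrow> y \<in> S)"
proof -
  obtain \<B> where \<B>: "finite \<B>" "\<forall>B\<in>\<B>. is_ball B"
    and sat: "\<And>x y. (\<And>B. B \<in> \<B> \<Longrightarrow> x \<in> B \<longleftrightarrow> y \<in> B) \<Longrightarrow> x \<in> S \<Longrightarrow> y \<in> S"
    using assms(1) unfolding few_balls_def by metis
  have "finite {x. {x} \<in> \<B>}"
    using finite_vimageI[OF \<B>(1), of "\<lambda>x. {x}"] by (simp add: inj_def vimage_def)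
  then obtain x where x: "x \<in> S" "{x} \<notin> \<B>"
    using assms(2) by (metis (mono_tags, lifting) finite_subset mem_Collect_eq subsetI)
  obtain c where "c \<noteq> 0"
    and c: "\<And>B y. B \<in> \<B> \<Longrightarrow> y \<noteq> x \<Longrightarrow> v c < v (y - x) \<Longrightarrow> y \<in> B \<longleftrightarrow> x \<in> B \<and> B \<noteq> {x}"
    using balls_near_point[of \<B> x] \<B> by blast
  then have "y \<in> S" if "v c < v (y - x)" for y
    using sat[OF _ x(1), of y] x that by (cases "y = x") blast+
  with x(1) \<open>c \<noteq> 0\<close> show ?thesis
    by blast
qed

end

section \<open>Uniform finiteness\<close>

definition supports :: "'u set \<Rightarrow> 'u set set \<Rightarrow> 'u set \<Rightarrow> bool" where
  "supports \<Omega> \<F> A \<longleftrightarrow>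
     (\<forall>x\<in>\<Omega>. \<forall>y\<in>\<Omega>. (\<forall>B\<in>\<F>. x \<in> B \<longleftrightarrow> y \<in> B) \<longrightarrow> (x \<in> A \<longleftrightarrow> y \<in> A))"

lemma supportsD:
  "supports \<Omega> \<F> A \<Longrightarrow> x \<in> \<Omega> \<Longrightarrow> y \<in> \<Omega> \<Longrightarrow> \<forall>B\<in>\<F>. x \<in> B \<longleftrightarrow> y \<in> B \<Longrightarrow> x \<in> A \<longleftrightarrow> y \<in> A"
  by (simp only: supports_def)

lemma boolean_combination_finite_support:
  "A \<in> boolean_combinations \<Omega> \<B> \<Longrightarrow> \<exists>\<F>. finite \<F> \<and> \<F> \<subseteq> \<B> \<and> supports \<Omega> \<F> A"
proof (induction rule: boolean_combinations.induct)
  case (base B)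
  then show ?case
    by (intro exI[of _ "{B}"]) (simp only: supports_def ball_simps, blast)
next
  case (compl A)
  then obtain \<F> where "finite \<F>" "\<F> \<subseteq> \<B>" "supports \<Omega> \<F> A"
    by blast
  moreover from this(3) have "supports \<Omega> \<F> (\<Omega> - A)"
  proof (unfold supports_def, intro ballI impI)
    fix x y
    assume "x \<in> \<Omega>" "y \<in> \<Omega>" "\<forall>B\<in>\<F>. x \<in> B \<longleftrightarrow> y \<in> B"
    moreover from this have "x \<in> A \<longleftrightarrow> y \<in> A"
      using \<open>supports \<Omega> \<F> A\<close> by (simp only: supports_def)
    ultimately show "x \<in> \<Omega> - A \<longleftrightarrow> y \<in> \<Omega> - A"
      by (simp only: Diff_iff)
  qed
  ultimately show ?case
    by blast
next
  case (inter A A')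
  then obtain \<F> \<G> where "finite \<F>" "\<F> \<subseteq> \<B>" "supports \<Omega> \<F> A"
    "finite \<G>" "\<G> \<subseteq> \<B>" "supports \<Omega> \<G> A'"
    by blast
  moreover from this(3,6) have "supports \<Omega> (\<F> \<union> \<G>) (A \<inter> A')"
  proof (unfold supports_def, intro ballI impI)
    fix x y
    assume xy: "x \<in> \<Omega>" "y \<in> \<Omega>" "\<forall>B\<in>\<F> \<union> \<G>. x \<in> B \<longleftrightarrow> y \<in> B"
    have "x \<in> A \<longleftrightarrow> y \<in> A" "x \<in> A' \<longleftrightarrow> y \<in> A'"
      using supportsD[OF \<open>supports \<Omega> \<F> A\<close> xy(1,2) conjunct1[OF xy(3)[unfolded ball_Un]]]
        supportsD[OF \<open>supports \<Omega> \<G> A'\<close> xy(1,2) conjunct2[OF xy(3)[unfolded ball_Un]]]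
      by this
    then show "x \<in> A \<inter> A' \<longleftrightarrow> y \<in> A \<inter> A'"
      by (simp only: Int_iff)
  qed
  ultimately show ?case
    by (intro exI[of _ "\<F> \<union> \<G>"]) simp
next
  case (union A A')
  then obtain \<F> \<G> where "finite \<F>" "\<F> \<subseteq> \<B>" "supports \<Omega> \<F> A"
    "finite \<G>" "\<G> \<subseteq> \<B>" "supports \<Omega> \<G> A'"
    by blast
  moreover from this(3,6) have "supports \<Omega> (\<F> \<union> \<G>) (A \<union> A')"
  proof (unfold supports_def, intro ballI impI)
    fix x y
    assume xy: "x \<in> \<Omega>" "y \<in> \<Omega>" "\<forall>B\<in>\<F> \<union> \<G>. x \<in> B \<longleftrightarrow> y \<in> B"
    have "x \<in> A \<longleftrightarrow> y \<in> A" "x \<in> A' \<longleftrightarrow> y \<in> A'"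
      using supportsD[OF \<open>supports \<Omega> \<F> A\<close> xy(1,2) conjunct1[OF xy(3)[unfolded ball_Un]]]
        supportsD[OF \<open>supports \<Omega> \<G> A'\<close> xy(1,2) conjunct2[OF xy(3)[unfolded ball_Un]]]
      by this
    then show "x \<in> A \<union> A' \<longleftrightarrow> y \<in> A \<union> A'"
      by (simp only: Un_iff)
  qed
  ultimately show ?case
    by (intro exI[of _ "\<F> \<union> \<G>"]) simp
qed

locale C_minimal_field =
  fixes v :: "'a::alg_closed_field \<Rightarrow> 'g::linordered_ab_group_add extended"
    and L :: "('f vf_fun, 'r vf_rel) language"
    and M :: "('f vf_fun, 'r vf_rel, 'a) struct"
  assumes C_minimal_valued_field: "C_minimal_valued_field v L M"
begin

sublocale valued_field v
  using C_minimal_valued_field by unfold_locales (simp add: C_minimal_valued_field_def)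

sublocale full_structure L M
  using C_minimal_valued_field
  by unfold_locales (simp add: C_minimal_valued_field_def expands_valued_field_def)

lemma interp [simp]:
  "fun_interp M Minus [x, y] = x - y" "fun_interp M Plus [x, y] = x + y"
  "fun_interp M Zero [] = 0" "rel_interp M Div [x, y] \<longleftrightarrow> v x \<le> v y"
  using C_minimal_valued_field
  by (simp_all add: C_minimal_valued_field_def expands_valued_field_def)

text \<open>Centre and radius of \<open>B\<close> are represented by sequences, and \<open>B\<close>
  is the ultraproduct of the balls in \<open>M\<close> with these centres and radii.\<close>

lemma ultrapower_ball:
  fixes B :: "('a, 'f, 'r) large set"
  assumes "free_ultrafilter ev"
    and B: "struct_closed_ball (free_ultrafilter.ultrapower ev M) B \<or>
      struct_open_ball (free_ultrafilter.ultrapower ev M) B"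
  shows "\<exists>\<beta>. (\<forall>n. is_ball (\<beta> n)) \<and>
    (\<forall>t. free_ultrafilter.cls ev t \<in> B \<longleftrightarrow> ev (\<lambda>n. t n \<in> \<beta> n))"
proof -
  interpret free_ultrafilter ev
    by fact
  let ?N = "ultrapower M :: ('f vf_fun, 'r vf_rel, ('a, 'f, 'r) large) struct"
  have N: "fun_interp ?N Minus [cls s, cls t] = cls (\<lambda>n. s n - t n)"
    "fun_interp ?N Zero [] = cls (\<lambda>n. 0)"
    "rel_interp ?N Div [cls s, cls t] \<longleftrightarrow> ev (\<lambda>n. v (s n) \<le> v (t n))" for s t
    using fun_interp_cls[of M Minus "[s, t]"] fun_interp_cls[of M Zero "[]"]
      rel_interp_cls[of M Div "[s, t]"] by simp_all
  from B consider (UNIV) "B = univ ?N"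
    | (closed) a c where "B = {x \<in> univ ?N. rel_interp ?N Div [cls c, fun_interp ?N Minus [x, cls a]]}"
    | (opened) a c where "cls c \<noteq> fun_interp ?N Zero []"
        "B = {x \<in> univ ?N. \<not> rel_interp ?N Div [fun_interp ?N Minus [x, cls a], cls c]}"
    unfolding struct_closed_ball_def struct_open_ball_def univ_ultrapower by blast
  then show ?thesis
  proof cases
    case UNIV
    then show ?thesis
      using is_ball_UNIV by (intro exI[of _ "\<lambda>_. UNIV"]) (simp add: univ_ultrapower ev_True)
  next
    case (closed a c)
    then show ?thesis
      using is_ball_closed
      by (intro exI[of _ "\<lambda>n. {x. v (c n) \<le> v (x - a n)}"]) (simp add: univ_ultrapower N)
  next
    case (opened a c)
    \<comment> \<open>The radius element is nonzero only at almost all indices. At the others the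
      formula would give the empty set, so \<open>UNIV\<close> is used to keep every component a
      ball.\<close>
    let ?\<beta> = "\<lambda>n. if c n = 0 then UNIV else {x. v (c n) < v (x - a n)}"
    have c: "ev (\<lambda>n. c n \<noteq> 0)"
      using opened(1) by (simp add: N cls_eq_iff ev_not)
    have "cls t \<in> B \<longleftrightarrow> ev (\<lambda>n. t n \<in> ?\<beta> n)" for t
    proof -
      have "cls t \<in> B \<longleftrightarrow> ev (\<lambda>n. \<not> v (t n - a n) \<le> v (c n))"
        unfolding opened(2) by (simp add: univ_ultrapower N ev_not)
      also have "\<dots> \<longleftrightarrow> ev (\<lambda>n. t n \<in> ?\<beta> n)"
        using c by (rule ev_cong2) (simp add: not_le)
      finally show ?thesis .
    qed
    moreover have "is_ball (?\<beta> n)" for n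
      using is_ball_UNIV open_ball_is_open by (simp add: is_ball_def)
    ultimately show ?thesis
      by (intro exI[of _ ?\<beta>]) blast
  qed
qed

text \<open>If there were parameters \<open>d n\<close> whose fibres need more than \<open>n\<close> balls, then the fibre over
  their class in an ultrapower would not be a boolean combination of balls, since the balls of
  the ultrapower are ultraproducts of balls.\<close>

theorem uniformly_few_balls:
  assumes "def_pred (\<lambda>e. Q (e 0) (\<lambda>n. e (Suc n)))"
  shows "\<exists>n. \<forall>e. few_balls n {x. Q x e}"
proof (rule ccontr)
  assume "\<nexists>n. \<forall>e. few_balls n {x. Q x e}"
  then obtain d where d: "\<And>n. \<not> few_balls n {x. Q x (d n)}"
    by metis
  obtain ev where "free_ultrafilter ev"
    using free_ultrafilter_exists ..
  then interpret free_ultrafilter ev .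
  let ?N = "ultrapower M :: ('f vf_fun, 'r vf_rel, ('a, 'f, 'r) large) struct"
  obtain p c where p: "form_in L p" "\<And>e. sat M (mix e c) p \<longleftrightarrow> Q (e 0) (\<lambda>n. e (Suc n))"
    using assms unfolding def_pred_def by blast
  \<comment> \<open>The slot holding \<open>undefined\<close> belongs to the coordinate
    \<open>x\<close> and is overwritten below by a sequence \<open>t\<close>; the rest consists of
    the bad parameters \<open>d n\<close> and of \<open>c\<close>.\<close>
  define s where "s i n = mix (case_nat undefined (d n)) c i" for i n
  define S where
    "S = {xs \<in> tuples ?N 1. sat ?N (\<lambda>i. if i < 1 then xs ! i else cls (s i)) p}"
  have "definable L ?N 1 S"
    unfolding definable_def S_def using p(1)
    by (intro exI[of _ p] exI[of _ "\<lambda>i. cls (s i)"]) (auto simp: univ_ultrapower)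
  then have "{x. [x] \<in> S} \<in> boolean_combinations (univ ?N)
      {B. struct_closed_ball ?N B \<or> struct_open_ball ?N B}"
    using C_minimal_valued_field is_struct_ultrapower[of L M] elem_equiv_ultrapower[OF univ, of L]
    unfolding C_minimal_valued_field_def C_minimal_def by blast
  from boolean_combination_finite_support[OF this] obtain \<F> where \<F>: "finite \<F>"
    "\<F> \<subseteq> {B. struct_closed_ball ?N B \<or> struct_open_ball ?N B}"
    and sat: "supports (univ ?N) \<F> {x. [x] \<in> S}"
    by blast
  have "\<exists>\<beta>. (\<forall>n. is_ball (\<beta> n)) \<and> (\<forall>t. cls t \<in> B \<longleftrightarrow> ev (\<lambda>n. t n \<in> \<beta> n))" if "B \<in> \<F>" for B
    using ultrapower_ball[OF free_ultrafilter_axioms, of B] \<F>(2) that by blast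
  then obtain \<beta> where \<beta>: "\<And>B n. B \<in> \<F> \<Longrightarrow> is_ball (\<beta> B n)"
    "\<And>B t. B \<in> \<F> \<Longrightarrow> cls t \<in> B \<longleftrightarrow> ev (\<lambda>n. t n \<in> \<beta> B n)"
    by metis
  have S: "[cls t] \<in> S \<longleftrightarrow> ev (\<lambda>n. Q (t n) (d n))" for t
  proof -
    have "sat ?N (\<lambda>i. if i < 1 then [cls t] ! i else cls (s i)) p \<longleftrightarrow>
        sat ?N (\<lambda>i. cls (if i < 1 then t else s i)) p"
      by (rule arg_cong[where f = "\<lambda>e. sat ?N e p"]) (simp add: fun_eq_iff)
    then have "[cls t] \<in> S \<longleftrightarrow> sat ?N (\<lambda>i. cls (if i < 1 then t else s i)) p"
      unfolding S_def by (simp only: mem_Collect_eq) (simp add: tuples_def univ_ultrapower)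
    also have "\<dots> \<longleftrightarrow> ev (\<lambda>n. sat M (\<lambda>i. (if i < 1 then t else s i) n) p)"
      using univ by (rule Los)
    also have "\<dots> \<longleftrightarrow> ev (\<lambda>n. sat M (mix (case_nat (t n) (d n)) c) p)"
    proof -
      have "(\<lambda>i. (if i < 1 then t else s i) n) = mix (case_nat (t n) (d n)) c" for n
        by (auto simp: s_def mix_def fun_eq_iff split: nat.split)
      then show ?thesis
        by simp
    qed
    finally show ?thesis
      unfolding p(2) by simp
  qed
  \<comment> \<open>Once \<open>n\<close> reaches \<open>card \<F>\<close>, the components at
    \<open>n\<close> are at most \<open>n\<close> balls. By the choice of \<open>d n\<close> they
    cannot describe the fibre, so some cell contains both a point inside and a point outside
    it.\<close>
  have "\<exists>x y. card \<F> \<le> n \<longrightarrow>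
      (\<forall>B\<in>\<F>. x \<in> \<beta> B n \<longleftrightarrow> y \<in> \<beta> B n) \<and> Q x (d n) \<and> \<not> Q y (d n)" for n
  proof (cases "card \<F> \<le> n")
    case True
    show ?thesis (is ?goal)
    proof (rule ccontr)
      assume neg: "\<not> ?goal"
      have "few_balls n {x. Q x (d n)}"
      proof (rule few_ballsI)
        show "card ((\<lambda>B. \<beta> B n) ` \<F>) \<le> n"
          using card_image_le[OF \<F>(1)] True order_trans by blast
        fix x y
        assume "\<forall>B \<in> (\<lambda>B. \<beta> B n) ` \<F>. x \<in> B \<longleftrightarrow> y \<in> B" and x: "x \<in> {x. Q x (d n)}"
        then have eq: "\<forall>B\<in>\<F>. x \<in> \<beta> B n \<longleftrightarrow> y \<in> \<beta> B n"
          by (simp only: ball_simps)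
        show "y \<in> {x. Q x (d n)}"
        proof (rule ccontr)
          assume "y \<notin> {x. Q x (d n)}"
          then have ?goal
            using x by (intro exI[of _ x] exI[of _ y] impI conjI eq) simp_all
          with neg show False
            by contradiction
        qed
      qed (use \<F>(1) \<beta>(1) in auto)
      with d[of n] show False
        by contradiction
    qed
  qed simp
  then obtain x y where xy: "\<And>n. card \<F> \<le> n \<Longrightarrow>
      (\<forall>B\<in>\<F>. x n \<in> \<beta> B n \<longleftrightarrow> y n \<in> \<beta> B n) \<and> Q (x n) (d n) \<and> \<not> Q (y n) (d n)"
    by metis
  have "cls x \<in> B \<longleftrightarrow> cls y \<in> B" if "B \<in> \<F>" for B
    unfolding \<beta>(2)[OF that] using ev_ge[of "card \<F>"] by (rule ev_cong2) (use xy that in blast)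
  then have "[cls x] \<in> S \<longleftrightarrow> [cls y] \<in> S"
    using supportsD[OF sat, of "cls x" "cls y"] by (simp add: univ_ultrapower)
  moreover have "ev (\<lambda>n. Q (x n) (d n))" "ev (\<lambda>n. \<not> Q (y n) (d n))"
    using ev_ge[of "card \<F>"] by (rule ev_mono; use xy in blast)+
  ultimately show False
    by (simp add: S ev_not)
qed

end

section \<open>Residue classes and definable families of functions\<close>

text \<open>Take \<open>j\<close> of least value among the indices with more than \<open>n\<close>
  elements at or below them. At most \<open>n\<close> elements are strictly below \<open>j\<close>,
  which leaves at least \<open>n + 1\<close> at or above it.\<close>

lemma median_exists:
  fixes w :: "'i \<Rightarrow> 'b::linorder"
  assumes "finite I" "card I = 2 * n + 1"
  shows "\<exists>j\<in>I. n < card {i \<in> I. w i \<le> w j} \<and> n < card {i \<in> I. w j \<le> w i}"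
proof -
  define J where "J = {j \<in> I. n < card {i \<in> I. w i \<le> w j}}"
  have I: "I \<noteq> {}" "finite (w ` I)"
    using assms by auto
  obtain m where m: "m \<in> I" "Max (w ` I) = w m"
    using Max_in[OF I(2)] I(1) by auto
  have "{i \<in> I. w i \<le> w m} = I"
    using I Max_ge[OF I(2)] m(2) by auto
  then have "m \<in> J"
    using m(1) assms(2) by (simp add: J_def)
  then have J: "finite (w ` J)" "J \<noteq> {}"
    using assms(1) by (auto simp: J_def)
  have "Min (w ` J) \<in> w ` J"
    using J by (intro Min_in) auto
  then obtain j where j: "j \<in> J" "Min (w ` J) = w j"
    by (elim imageE)
  \<comment> \<open>The elements strictly below \<open>j\<close> are those up to a largest one
    \<open>k\<close> among them, and \<open>k\<close> is not in \<open>J\<close> by minimality of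
    \<open>j\<close>.\<close>
  have "card {i \<in> I. w i < w j} \<le> n"
  proof (cases "{i \<in> I. w i < w j} = {}")
    case True
    then show ?thesis
      by (simp only: card.empty)
  next
    case False
    let ?A = "{i \<in> I. w i < w j}"
    have A: "finite (w ` ?A)" "w ` ?A \<noteq> {}"
      using assms(1) False by auto
    obtain k where k: "k \<in> ?A" "Max (w ` ?A) = w k"
      using Max_in[OF A] by auto
    have "?A = {i \<in> I. w i \<le> w k}"
      using k(1) Max_ge[OF A(1)] k(2) by (auto intro: le_less_trans)
    moreover have "k \<notin> J"
      using k(1) j(2) Min_le[OF J(1), of "w k"] by auto
    ultimately show ?thesis
      using k(1) by (simp add: J_def)
  qed
  moreover have "I = {i \<in> I. w i < w j} \<union> {i \<in> I. w j \<le> w i}"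
    by auto
  then have "card I \<le> card {i \<in> I. w i < w j} + card {i \<in> I. w j \<le> w i}"
    by (metis card_Un_le)
  ultimately show ?thesis
    using j(1) assms(2) by (intro bexI[of _ j]) (auto simp: J_def)
qed

section \<open>Balls against residue classes\<close>

context valued_field
begin

abbreviation open_ball :: "'a \<Rightarrow> 'a \<Rightarrow> 'a set" where
  "open_ball x c \<equiv> {y. v c < v (y - x)}"

lemma ball_convex:
  assumes "is_ball B" "y \<in> B" "y' \<in> B" "v (y' - y) \<le> v (z - y)"
  shows "z \<in> B"
proof -
  consider a \<gamma> where "B = {x. \<gamma> \<le> v (x - a)}" | a \<gamma> where "B = {x. \<gamma> < v (x - a)}"
    using assms(1) unfolding is_ball_def is_closed_ball_def is_open_ball_def by blast
  then show ?thesis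
  proof cases
    case (1 a \<gamma>)
    then have "\<gamma> \<le> v (y' - a)" "\<gamma> \<le> v (y - a)"
      using assms by auto
    moreover have "\<gamma> \<le> v (y' - y)"
      using v_le_trans[of \<gamma> y' a y] calculation v_commute[of a y] by simp
    then have "\<gamma> \<le> v (z - y)"
      using assms(4) by (rule order_trans)
    ultimately show ?thesis
      using 1 v_le_trans[of \<gamma> z y a] by simp
  next
    case (2 a \<gamma>)
    then have "\<gamma> < v (y' - a)" "\<gamma> < v (y - a)"
      using assms by auto
    moreover have "\<gamma> < v (y' - y)"
      using v_less_trans[of \<gamma> y' a y] calculation v_commute[of a y] by simp
    then have "\<gamma> < v (z - y)"
      using assms(4) by (rule less_le_trans)
    ultimately show ?thesis
      using 2 v_less_trans[of \<gamma> z y a] by simp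
  qed
qed

text \<open>The open balls of radius \<open>v d\<close> around points of \<open>C\<close> are
  distinct maximal open subballs of one closed ball of radius \<open>v d\<close>, that is, residue
  classes after rescaling by \<open>d\<close>.\<close>

definition residue_centres :: "'a \<Rightarrow> 'a set \<Rightarrow> bool" where
  "residue_centres d C \<longleftrightarrow> finite C \<and> (\<forall>a\<in>C. \<forall>b\<in>C. a \<noteq> b \<longrightarrow> v (a - b) = v d)"

lemma residue_classes_distance:
  assumes "residue_centres d C" "a \<in> C" "b \<in> C" "y \<in> open_ball a d" "z \<in> open_ball b d"
  shows "v d \<le> v (y - z)" and "a \<noteq> b \<Longrightarrow> v (y - z) = v d"
proof -
  have yz: "v d < v (y - a)" "v d < v (z - b)"
    using assms by auto
  have "v d \<le> v (a - b)"
    using assms by (cases "a = b") (auto simp: residue_centres_def)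
  then have "v d \<le> v (y - b)"
    using v_le_trans[of "v d" y a b] yz by simp
  then show *: "v d \<le> v (y - z)"
    using v_le_trans[of "v d" y b z] yz v_commute[of b z] by simp
  assume "a \<noteq> b"
  then have ab: "v (a - b) = v d"
    using assms by (simp add: residue_centres_def)
  have "\<not> v d < v (y - z)"
  proof
    assume "v d < v (y - z)"
    then have "v d < v (a - b)"
      using v_less_trans[of "v d" a y z] v_less_trans[of "v d" a z b] yz v_commute[of a y] by simp
    then show False
      using ab by simp
  qed
  with * show "v (y - z) = v d"
    by simp
qed

text \<open>A ball meeting two classes contains all of them by \<open>ball_convex\<close>. Otherwise
  it meets at most one class, which is taken as the exception \<open>c0\<close>.\<close>

lemma ball_separates_one_class:
  assumes "is_ball B" "residue_centres d C"
  shows "\<exists>c0. \<forall>a\<in>C - {c0}. \<forall>b\<in>C - {c0}. \<forall>y\<in>open_ball a d. \<forall>z\<in>open_ball b d. y \<in> B \<longrightarrow> z \<in> B"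
proof (cases "\<exists>a\<in>C. \<exists>b\<in>C. a \<noteq> b \<and> open_ball a d \<inter> B \<noteq> {} \<and> open_ball b d \<inter> B \<noteq> {}")
  case True
  then obtain a b y y' where ab: "a \<in> C" "b \<in> C" "a \<noteq> b" "y \<in> open_ball a d" "y \<in> B"
    "y' \<in> open_ball b d" "y' \<in> B"
    by blast
  have "z \<in> B" if "c \<in> C" "z \<in> open_ball c d" for c z
  proof (rule ball_convex[OF assms(1) ab(5,7)])
    show "v (y' - y) \<le> v (z - y)"
      using residue_classes_distance(2)[OF assms(2) ab(2,1,6,4)] ab(3)
        residue_classes_distance(1)[OF assms(2) that(1) ab(1) that(2) ab(4)] by simp
  qed
  then show ?thesis
    by blast
next
  case False
  then obtain c0 where "\<And>c. c \<in> C \<Longrightarrow> c \<noteq> c0 \<Longrightarrow> open_ball c d \<inter> B = {}"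
    by metis
  then have "y \<notin> B" if "a \<in> C - {c0}" "y \<in> open_ball a d" for a y
    using that by blast
  then show ?thesis
    by blast
qed

text \<open>Each ball has at most one exceptional class. Outside these at most \<open>n\<close>
  classes all points lie in one cell, so \<open>S\<close> contains all remaining classes or meets
  none of them.\<close>

lemma few_balls_residue_classes:
  assumes "few_balls n S" "residue_centres d C"
  shows "card {c \<in> C. \<not> open_ball c d \<subseteq> S} \<le> n \<or> card {c \<in> C. open_ball c d \<inter> S \<noteq> {}} \<le> n"
proof -
  obtain \<B> where \<B>: "finite \<B>" "card \<B> \<le> n" "\<And>B. B \<in> \<B> \<Longrightarrow> is_ball B"
    and sat: "\<And>x y. (\<And>B. B \<in> \<B> \<Longrightarrow> x \<in> B \<longleftrightarrow> y \<in> B) \<Longrightarrow> x \<in> S \<Longrightarrow> y \<in> S"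
    using assms(1) unfolding few_balls_def by metis
  have "\<exists>c0. \<forall>a\<in>C - {c0}. \<forall>b\<in>C - {c0}. \<forall>y\<in>open_ball a d. \<forall>z\<in>open_ball b d. y \<in> B \<longrightarrow> z \<in> B"
    if "B \<in> \<B>" for B
    using ball_separates_one_class[OF \<B>(3)[OF that] assms(2)] .
  then obtain c0 where c0: "\<And>B a b y z. B \<in> \<B> \<Longrightarrow> a \<in> C - {c0 B} \<Longrightarrow> b \<in> C - {c0 B} \<Longrightarrow>
      y \<in> open_ball a d \<Longrightarrow> z \<in> open_ball b d \<Longrightarrow> y \<in> B \<Longrightarrow> z \<in> B"
    by metis
  have card: "finite (c0 ` \<B>)" "card (c0 ` \<B>) \<le> n"
    using \<B>(1,2) card_image_le[OF \<B>(1), of c0] by auto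
  have same: "z \<in> S" if "a \<in> C - c0 ` \<B>" "b \<in> C - c0 ` \<B>" "y \<in> open_ball a d" "z \<in> open_ball b d"
    "y \<in> S" for a b y z
  proof (rule sat[OF _ that(5)])
    fix B
    assume "B \<in> \<B>"
    then show "y \<in> B \<longleftrightarrow> z \<in> B"
      using c0[of B a b y z] c0[of B b a z y] that by auto
  qed
  show ?thesis
  proof (cases "\<exists>a\<in>C - c0 ` \<B>. open_ball a d \<inter> S \<noteq> {}")
    case True
    then have "{c \<in> C. \<not> open_ball c d \<subseteq> S} \<subseteq> c0 ` \<B>"
      using same by blast
    from card_mono[OF card(1) this] show ?thesis
      using card(2) by simp
  next
    case False
    then have "{c \<in> C. open_ball c d \<inter> S \<noteq> {}} \<subseteq> c0 ` \<B>"
      by blast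
    from card_mono[OF card(1) this] show ?thesis
      using card(2) by simp
  qed
qed

text \<open>If \<open>g\<close> were nonconstant on all classes, with larger value \<open>w c\<close> on the class of \<open>c\<close>, then
  cutting at the median of the values \<open>w c\<close> would give a set that neither contains nor avoids
  almost all classes.\<close>

lemma constant_on_residue_class:
  fixes g :: "'a \<Rightarrow> 'b::linorder"
  assumes C: "residue_centres d C" "card C = 2 * n + 1"
    and S: "\<And>z. z \<in> (\<Union>c\<in>C. open_ball c d) \<Longrightarrow> few_balls n (S z)"
      "\<And>y z. y \<in> (\<Union>c\<in>C. open_ball c d) \<Longrightarrow> z \<in> (\<Union>c\<in>C. open_ball c d) \<Longrightarrow>
        y \<in> S z \<longleftrightarrow> g y < g z"
  shows "\<exists>c\<in>C. \<forall>y\<in>open_ball c d. \<forall>z\<in>open_ball c d. g y = g z"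
proof (rule ccontr)
  assume neg: "\<not> ?thesis"
  have "\<exists>y z. y \<in> open_ball c d \<and> z \<in> open_ball c d \<and> g y < g z" if "c \<in> C" for c
    using neg that by (metis linorder_neqE)
  then obtain y z where yz: "\<And>c. c \<in> C \<Longrightarrow> y c \<in> open_ball c d"
    "\<And>c. c \<in> C \<Longrightarrow> z c \<in> open_ball c d" "\<And>c. c \<in> C \<Longrightarrow> g (y c) < g (z c)"
    by metis
  have fin: "finite C"
    using C(1) by (simp add: residue_centres_def)
  obtain j where j: "j \<in> C" "n < card {c \<in> C. g (z c) \<le> g (z j)}"
    "n < card {c \<in> C. g (z j) \<le> g (z c)}"
    using median_exists[OF fin C(2), of "\<lambda>c. g (z c)"] by blast
  have un: "y c \<in> (\<Union>c\<in>C. open_ball c d)" "z c \<in> (\<Union>c\<in>C. open_ball c d)" if "c \<in> C" for c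
    using yz that by blast+
  \<comment> \<open>Cutting at \<open>g (z j)\<close>: a class with \<open>g (z c)\<close> at most
    this value meets the set in \<open>y c\<close>, and a class with \<open>g (z c)\<close> at least
    this value leaves it in \<open>z c\<close>.\<close>
  have "{c \<in> C. g (z c) \<le> g (z j)} \<subseteq> {c \<in> C. open_ball c d \<inter> S (z j) \<noteq> {}}"
    using yz S(2)[OF un(1) un(2)[OF j(1)]] less_le_trans by blast
  from card_mono[OF _ this] have 1: "n < card {c \<in> C. open_ball c d \<inter> S (z j) \<noteq> {}}"
    using j(2) fin by simp
  have "{c \<in> C. g (z j) \<le> g (z c)} \<subseteq> {c \<in> C. \<not> open_ball c d \<subseteq> S (z j)}"
    using yz S(2)[OF un(2) un(2)[OF j(1)]] not_le by blast
  from card_mono[OF _ this] have 2: "n < card {c \<in> C. \<not> open_ball c d \<subseteq> S (z j)}"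
    using j(3) fin by simp
  show False
    using few_balls_residue_classes[OF S(1)[OF un(2)[OF j(1)]] C(1)] 1 2 by simp
qed

text \<open>Ultrametric triangles are isosceles, so the strict inequality already forces the
  equality demanded by the C-relation.\<close>

lemma C_rel_iff: "C_rel v x y z \<longleftrightarrow> v (y - x) < v (y - z)"
proof
  assume *: "v (y - x) < v (y - z)"
  have "v (x - y) \<le> v (x - z)"
    using v_le_trans[of "v (x - y)" x y z] * v_commute[of x y] by simp
  moreover have "\<not> v (x - y) < v (x - z)"
    using v_less_trans[of "v (x - y)" x z y] * v_commute[of x y] v_commute[of z y] by auto
  ultimately have "v (x - y) = v (x - z)"
    by simp
  with * show "C_rel v x y z"
    using v_commute[of x y] by (simp add: C_rel_def)
qed (auto simp: C_rel_def v_commute[of y x])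

end

section \<open>Infinitely many residue classes, and definability of valuation inequalities\<close>

context C_minimal_field
begin

text \<open>A root \<open>t\<close> of the product of all \<open>X - s\<close>, plus 1, makes the
  values of the factors \<open>t - s\<close> sum to 0. If \<open>v t\<close> were negative, all
  these values would be; hence they are nonnegative, and therefore all 0.\<close>

lemma residue_field_extend:
  assumes "finite T" "\<And>t. t \<in> T \<Longrightarrow> Fin 0 \<le> v t"
  shows "\<exists>t. Fin 0 \<le> v t \<and> (\<forall>s\<in>T. v (t - s) = Fin 0)"
proof (cases "T = {}")
  case True
  then show ?thesis
    by (intro exI[of _ 0]) simp
next
  case False
  define p where "p = (\<Prod>s\<in>T. [:- s, 1:])"
  have "degree p = card T"
    unfolding p_def by (subst degree_prod_eq_sum_degree) auto
  then have "degree (p + 1) > 0"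
    using False assms(1) by (subst degree_add_eq_left) (auto simp: card_gt_0_iff)
  then obtain t where "poly (p + 1) t = 0"
    using alg_closed_imp_poly_has_root by blast
  then have t: "(\<Prod>s\<in>T. t - s) = - 1"
    by (simp add: p_def poly_prod eq_neg_iff_add_eq_0)
  then have "t \<noteq> s" if "s \<in> T" for s
    using that assms(1) prod_zero[of T "\<lambda>s. t - s"] by auto
  then have "\<exists>\<gamma>. v (t - s) = Fin \<gamma>" if "s \<in> T" for s
    using v_Fin that by simp
  then obtain \<gamma> where \<gamma>: "\<And>s. s \<in> T \<Longrightarrow> v (t - s) = Fin (\<gamma> s)"
    by metis
  have "v (\<Prod>s\<in>T. t - s) = Fin (\<Sum>s\<in>T. \<gamma> s)"
    using assms(1) \<gamma> by (induction T rule: finite_induct) (simp_all add: v_mult)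
  then have sum: "(\<Sum>s\<in>T. \<gamma> s) = 0"
    using t by simp
  have nonneg: "Fin 0 \<le> v t"
  proof (rule ccontr)
    assume neg: "\<not> Fin 0 \<le> v t"
    have "\<gamma> s < 0" if "s \<in> T" for s
    proof (rule ccontr)
      assume "\<not> \<gamma> s < 0"
      then have "Fin 0 \<le> v (t - s)"
        using \<gamma>[OF that] by simp
      then show False
        using neg v_le_trans[of "Fin 0" t s 0] assms(2)[OF that] by simp
    qed
    then have "(\<Sum>s\<in>T. \<gamma> s) < (\<Sum>s\<in>T. 0)"
      using assms(1) False by (intro sum_strict_mono) auto
    then show False
      using sum by simp
  qed
  have "0 \<le> \<gamma> s" if "s \<in> T" for s
    using v_le_trans[of "Fin 0" t 0 s] nonneg assms(2)[OF that] \<gamma>[OF that] by simp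
  then have "\<gamma> s = 0" if "s \<in> T" for s
    using sum that assms(1) by (simp add: sum_nonneg_eq_0_iff)
  then show ?thesis
    using nonneg \<gamma> by auto
qed

lemma residue_field_infinite:
  "\<exists>T. card T = n \<and> finite T \<and> (\<forall>t\<in>T. Fin 0 \<le> v t) \<and>
    (\<forall>s\<in>T. \<forall>t\<in>T. s \<noteq> t \<longrightarrow> v (s - t) = Fin 0)"
proof (induction n)
  case (Suc n)
  then obtain T where T: "card T = n" "finite T" "\<And>t. t \<in> T \<Longrightarrow> Fin 0 \<le> v t"
    "\<And>s t. s \<in> T \<Longrightarrow> t \<in> T \<Longrightarrow> s \<noteq> t \<Longrightarrow> v (s - t) = Fin 0"
    by metis
  obtain t where t: "Fin 0 \<le> v t" "\<And>s. s \<in> T \<Longrightarrow> v (t - s) = Fin 0"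
    using residue_field_extend[OF T(2,3)] by blast
  then have "t \<notin> T"
    by force
  then have "card (insert t T) = Suc n"
    using T by simp
  moreover have "v (s - u) = Fin 0" if "s \<in> insert t T" "u \<in> insert t T" "s \<noteq> u" for s u
    using that T(4) t(2) v_commute[of s t] by auto
  ultimately show ?case
    using T(2,3) t(1) by (intro exI[of _ "insert t T"]) auto
qed (intro exI[of _ "{}"], simp)

lemma ex_residue_centres:
  assumes "d \<noteq> 0"
  shows "\<exists>C. residue_centres d C \<and> card C = n \<and> (\<forall>c\<in>C. v d \<le> v (c - x))"
proof -
  obtain T where T: "card T = n" "finite T" "\<And>t. t \<in> T \<Longrightarrow> Fin 0 \<le> v t"
    "\<And>s t. s \<in> T \<Longrightarrow> t \<in> T \<Longrightarrow> s \<noteq> t \<Longrightarrow> v (s - t) = Fin 0"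
    using residue_field_infinite[of n] by metis
  obtain \<delta> where \<delta>: "v d = Fin \<delta>"
    using v_Fin[OF assms] ..
  have mult: "v (x + d * s - (x + d * t)) = Fin \<delta> + v (s - t)" for s t
    using v_mult[of d "s - t"] \<delta> by (simp add: algebra_simps)
  have "inj_on (\<lambda>t. x + d * t) T"
    using assms by (simp add: inj_on_def)
  then have "card ((\<lambda>t. x + d * t) ` T) = n"
    using T(1) by (simp add: card_image)
  moreover have "residue_centres d ((\<lambda>t. x + d * t) ` T)"
    unfolding residue_centres_def using T(2,4) mult \<delta> by auto
  moreover have "v d \<le> v (x + d * t - x)" if "t \<in> T" for t
  proof -
    have "Fin \<delta> + Fin 0 \<le> Fin \<delta> + v t"
      using T(3)[OF that] by (rule add_left_mono)
    then show ?thesis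
      using \<delta> by (simp add: v_mult)
  qed
  ultimately show ?thesis
    by (intro exI[of _ "(\<lambda>t. x + d * t) ` T"]) auto
qed

lemma def_term_minus: "def_term f \<Longrightarrow> def_term g \<Longrightarrow> def_term (\<lambda>e. f e - g e)"
  and def_term_plus: "def_term f \<Longrightarrow> def_term g \<Longrightarrow> def_term (\<lambda>e. f e + g e)"
  and def_pred_v_le: "def_term f \<Longrightarrow> def_term g \<Longrightarrow> def_pred (\<lambda>e. v (f e) \<le> v (g e))"
proof -
  have "(Minus, 2) \<in> fun_syms L" "(Plus, 2) \<in> fun_syms L" "(Div, 2) \<in> rel_syms L"
    using C_minimal_valued_field
    by (auto simp: C_minimal_valued_field_def extends_L_div_def L_div_def)
  then show "def_term f \<Longrightarrow> def_term g \<Longrightarrow> def_term (\<lambda>e. f e - g e)"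
    "def_term f \<Longrightarrow> def_term g \<Longrightarrow> def_term (\<lambda>e. f e + g e)"
    "def_term f \<Longrightarrow> def_term g \<Longrightarrow> def_pred (\<lambda>e. v (f e) \<le> v (g e))"
    using def_term_App2[of Minus f g] def_term_App2[of Plus f g] def_pred_Rel2[of Div f g]
    by simp_all
qed

lemma def_pred_v_less: "def_term f \<Longrightarrow> def_term g \<Longrightarrow> def_pred (\<lambda>e. v (f e) < v (g e))"
  using def_pred_not[OF def_pred_v_le, of g f] by (simp add: not_le)

lemma def_pred_v_eq: "def_term f \<Longrightarrow> def_term g \<Longrightarrow> def_pred (\<lambda>e. v (f e) = v (g e))"
  using def_pred_conj[OF def_pred_v_le def_pred_v_le, of f g g f] by (simp add: order_eq_iff)

end

section \<open>Local factorization\<close>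

locale definable_local_C_isomorphism = C_minimal_field v L M
  for v :: "'a::alg_closed_field \<Rightarrow> 'g::linordered_ab_group_add extended"
    and L :: "('f vf_fun, 'r vf_rel) language"
    and M :: "('f vf_fun, 'r vf_rel, 'a) struct" +
  fixes X :: "'a set" and f :: "'a \<Rightarrow> 'a"
  assumes definable: "definable_fun L M X f"
    and local_C_iso: "local_C_isomorphism v X f"
begin

text \<open>Only the graph over \<open>X\<close> is definable, so \<open>f\<close> cannot occur
  inside definable terms; its values are introduced by quantifiers over
  \<open>graph\<close>.\<close>

definition graph :: "'a \<Rightarrow> 'a \<Rightarrow> bool" where
  "graph x y \<longleftrightarrow> x \<in> X \<and> y = f x"

lemma graph_f: "x \<in> X \<Longrightarrow> graph x a \<longleftrightarrow> a = f x"
  by (simp add: graph_def)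

lemma def_pred_graph:
  assumes "def_term s" "def_term t"
  shows "def_pred (\<lambda>e. graph (s e) (t e))"
proof (rule def_pred_subst2[OF definable_2_imp_def_pred assms])
  have "{[x, y] | x y. graph x y} = {[x, f x] | x. x \<in> X}"
    by (auto simp: graph_def)
  then show "definable L M 2 {[x, y] | x y. graph x y}"
    using definable by (simp add: definable_fun_def)
qed

lemmas def_intros = def_pred_imp def_pred_conj def_pred_not def_pred_all def_pred_ex
  def_pred_graph def_pred_v_le def_pred_v_less def_pred_v_eq def_pred_eq
  def_term_minus def_term_plus def_term_var def_term_const

text \<open>Expresses that \<open>f\<close> is injective on the ball and that
  \<open>v (f y - f z)\<close> depends only on \<open>v (y - z)\<close>. The factoring function
  itself is not mentioned, which keeps the condition first-order.\<close>

definition good :: "'a \<Rightarrow> 'a \<Rightarrow> bool" where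
  "good x c \<longleftrightarrow> c \<noteq> 0 \<and> open_ball x c \<subseteq> X \<and>
     (\<forall>y\<in>open_ball x c. \<forall>z\<in>open_ball x c. \<forall>y'\<in>open_ball x c. \<forall>z'\<in>open_ball x c.
        (v (y - z) = v (y' - z') \<longrightarrow> v (f y - f z) = v (f y' - f z')) \<and> (y \<noteq> z \<longrightarrow> f y \<noteq> f z))"

lemma good_iff_graph:
  "good x c \<longleftrightarrow> c \<noteq> 0 \<and> (\<forall>y. v c < v (y - x) \<longrightarrow> (\<exists>a. graph y a)) \<and>
     (\<forall>y z y' z' a b a' b'. v c < v (y - x) \<and> v c < v (z - x) \<and> v c < v (y' - x) \<and>
        v c < v (z' - x) \<and> graph y a \<and> graph z b \<and> graph y' a' \<and> graph z' b' \<longrightarrow>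
        (v (y - z) = v (y' - z') \<longrightarrow> v (a - b) = v (a' - b')) \<and> (y \<noteq> z \<longrightarrow> a \<noteq> b))"
  (is "_ \<longleftrightarrow> c \<noteq> 0 \<and> ?X \<and> ?eq")
proof -
  have "?X \<longleftrightarrow> open_ball x c \<subseteq> X"
    by (auto simp: graph_def)
  moreover have "?eq \<longleftrightarrow> (\<forall>y\<in>open_ball x c. \<forall>z\<in>open_ball x c. \<forall>y'\<in>open_ball x c.
      \<forall>z'\<in>open_ball x c. (v (y - z) = v (y' - z') \<longrightarrow> v (f y - f z) = v (f y' - f z')) \<and>
        (y \<noteq> z \<longrightarrow> f y \<noteq> f z))" if sub: "open_ball x c \<subseteq> X"
  proof -
    have "y \<in> X" if "v c < v (y - x)" for y
      using sub that by blast
    then show ?thesis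
      by (simp add: graph_def imp_conjL Ball_def)
  qed
  ultimately show ?thesis
    unfolding good_def by blast
qed

lemma def_pred_good: "def_term s \<Longrightarrow> def_term t \<Longrightarrow> def_pred (\<lambda>e. good (s e) (t e))"
proof (rule def_pred_subst2[where G = good])
  show "def_pred (\<lambda>e. good (e 1) (e 0))"
    unfolding good_iff_graph by (intro def_intros)
qed

lemma good_mono:
  assumes "good x c" "open_ball y d \<subseteq> open_ball x c" "d \<noteq> 0"
  shows "good y d"
  using assms unfolding good_def by (meson subset_iff)

lemma open_ball_eq:
  assumes "y \<in> open_ball x c"
  shows "open_ball y c = open_ball x c"
  using assms v_less_trans[of "v c" _ x y] v_less_trans[of "v c" _ y x] v_commute[of x y] by auto

text \<open>With the shared point \<open>x\<close> in the second place of the C-relation, its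
  preservation compares distances from \<open>x\<close>. So equal distances from \<open>x\<close>
  are carried to equal distances from \<open>f x\<close>.\<close>

lemma C_isomorphismD:
  assumes "C_isomorphism v B f" "x \<in> B" "y \<in> B" "z \<in> B"
  shows "v (x - y) < v (x - z) \<longleftrightarrow> v (f x - f y) < v (f x - f z)"
proof -
  have "C_rel v y x z \<longleftrightarrow> C_rel v (f y) (f x) (f z)"
    using assms unfolding C_isomorphism_def by blast
  then show ?thesis
    by (simp add: C_rel_iff)
qed

text \<open>Shows that good points are dense. The good ball is centred in a residue class selected
  by a counting argument, so it need not contain \<open>x\<close>.\<close>

lemma good_ball_in_C_isomorphism:
  assumes "C_isomorphism v B f" "c \<noteq> 0" "open_ball x c \<subseteq> B" "B \<subseteq> X"
  shows "\<exists>y\<in>open_ball x c. \<exists>d. good y d"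
proof -
  note iso = C_isomorphismD[OF assms(1)]
  \<comment> \<open>The inequality \<open>v (f y - f (y + u)) < v (f z - f (z + u))\<close> with
    \<open>u = e 0\<close> and \<open>z = e 1\<close>. Both are parameters, which makes the bound
    \<open>n\<close> uniform in them.\<close>
  define Q where "Q y e \<longleftrightarrow> (\<exists>a b a' b'. graph y a \<and> graph (y + e 0) b \<and>
    graph (e 1) a' \<and> graph (e 1 + e 0) b' \<and> v (a - b) < v (a' - b'))" for y and e :: "nat \<Rightarrow> 'a"
  have "def_pred (\<lambda>e. Q (e 0) (\<lambda>n. e (Suc n)))"
    unfolding Q_def by (intro def_intros)
  then obtain n where n: "\<And>e. few_balls n {y. Q y e}"
    using uniformly_few_balls by blast
  obtain d where d: "d \<noteq> 0" "v c < v d"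
    using ex_larger_v[OF assms(2)] by blast
  obtain C where C: "residue_centres d C" "card C = 2 * n + 1" "\<And>c. c \<in> C \<Longrightarrow> v d \<le> v (c - x)"
    using ex_residue_centres[OF d(1)] by blast
  have sub: "open_ball a d \<subseteq> open_ball x c" if "a \<in> C" for a
    using v_less_trans[of "v c" _ a x] d(2) C(3)[OF that] by (auto intro: less_trans less_le_trans)
  have shift: "y + u \<in> open_ball a d" if "y \<in> open_ball a d" "v d < v u" for a y u
    using that v_less_trans[of "v d" "y + u" y a] by simp
  have B: "y \<in> X" "y \<in> B" if "a \<in> C" "y \<in> open_ball a d" for a y
    using sub[OF that(1)] that(2) assms(3,4) by blast+
  \<comment> \<open>The shifts \<open>u\<close> for which \<open>v (f y - f (y + u))\<close> is
    constant on the class of \<open>a\<close>. These sets cover all \<open>u\<close> with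
    \<open>v d < v u\<close>.\<close>
  define Z where "Z a = {u. \<forall>y z b b' c c'. v d < v (y - a) \<and> v d < v (z - a) \<and> graph y b \<and>
    graph (y + u) b' \<and> graph z c \<and> graph (z + u) c' \<longrightarrow> v (b - b') = v (c - c')}" for a
  have few_Z: "\<exists>k. few_balls k (Z a)" for a
  proof -
    have "def_pred (\<lambda>e. \<forall>y z b b' c c'. v d < v (y - a) \<and> v d < v (z - a) \<and> graph y b \<and>
      graph (y + e 0) b' \<and> graph z c \<and> graph (z + e 0) c' \<longrightarrow> v (b - b') = v (c - c'))"
      by (intro def_intros)
    from uniformly_few_balls[OF this] show ?thesis
      unfolding Z_def by blast
  qed
  have Z: "\<exists>a\<in>C. u \<in> Z a" if u: "v d < v u" for u
  proof -
    have "\<exists>a\<in>C. \<forall>y\<in>open_ball a d. \<forall>z\<in>open_ball a d. v (f y - f (y + u)) = v (f z - f (z + u))"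
    proof (rule constant_on_residue_class[OF C(1,2)])
      fix z
      show "few_balls n {y. Q y (\<lambda>i. if i = 0 then u else z)}"
        by (rule n)
      fix y
      assume "y \<in> (\<Union>a\<in>C. open_ball a d)" "z \<in> (\<Union>a\<in>C. open_ball a d)"
      then have "y \<in> X" "z \<in> X" "y + u \<in> X" "z + u \<in> X"
        using B(1) shift u by blast+
      then show "y \<in> {y. Q y (\<lambda>i. if i = 0 then u else z)} \<longleftrightarrow>
          v (f y - f (y + u)) < v (f z - f (z + u))"
        by (simp add: Q_def graph_f)
    qed
    then obtain a where a: "a \<in> C" "\<And>y z. y \<in> open_ball a d \<Longrightarrow> z \<in> open_ball a d \<Longrightarrow>
        v (f y - f (y + u)) = v (f z - f (z + u))"
      by blast
    then have "u \<in> Z a"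
      unfolding Z_def by (auto simp: graph_def)
    with a(1) show ?thesis ..
  qed
  \<comment> \<open>Each of the finitely many definable sets \<open>Z a\<close> contains all or none
    of the small nonzero shifts. They cannot all contain none, since together they cover.\<close>
  have "\<exists>a\<in>C. \<exists>r. r \<noteq> 0 \<and> (\<forall>u. u \<noteq> 0 \<longrightarrow> v r < v u \<longrightarrow> u \<in> Z a)"
  proof (rule ccontr)
    assume neg: "\<not> ?thesis"
    have "\<exists>r. r \<noteq> 0 \<and> (\<forall>u. u \<noteq> 0 \<longrightarrow> v r < v u \<longrightarrow> u \<notin> Z a)" if "a \<in> C" for a
    proof -
      obtain k where "few_balls k (Z a)"
        using few_Z ..
      from few_balls_near_point[OF this, of 0] neg that show ?thesis
        by simp blast
    qed
    then have "\<exists>r. r \<noteq> 0 \<and> (\<forall>a\<in>C. \<forall>u. u \<noteq> 0 \<longrightarrow> v r < v u \<longrightarrow> u \<notin> Z a)"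
      using C(1) by (intro ex_common_radius[where P = "\<lambda>a \<gamma>. \<forall>u. u \<noteq> 0 \<longrightarrow> \<gamma> < v u \<longrightarrow> u \<notin> Z a"])
        (auto simp: residue_centres_def)
    then obtain r where r: "r \<noteq> 0" "\<And>a u. a \<in> C \<Longrightarrow> u \<noteq> 0 \<Longrightarrow> v r < v u \<Longrightarrow> u \<notin> Z a"
      by blast
    obtain s where s: "s \<noteq> 0" "v r < v s"
      using ex_larger_v[OF r(1)] by blast
    obtain t where t: "t \<noteq> 0" "v d < v t"
      using ex_larger_v[OF d(1)] by blast
    obtain u where "u \<noteq> 0" "v r < v u" "v d < v u"
      using s t by (cases "v s \<le> v t") (auto intro: less_le_trans)
    then show False
      using Z r(2) by blast
  qed
  then obtain a r where a: "a \<in> C" "r \<noteq> 0" "\<And>u. u \<noteq> 0 \<Longrightarrow> v r < v u \<Longrightarrow> u \<in> Z a"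
    by blast
  \<comment> \<open>The radius \<open>v s\<close> keeps the ball inside the class of
    \<open>a\<close> and makes every difference of distinct points in it a shift in
    \<open>Z a\<close>.\<close>
  obtain s where s: "s \<noteq> 0" "v r \<le> v s" "v d \<le> v s"
    using a(2) d(1) by (cases "v r \<le> v d") auto
  have in_class: "y \<in> open_ball a d" if "y \<in> open_ball a s" for y
    using that s(3) by auto
  have "good a s"
    unfolding good_def
  proof (intro conjI ballI impI)
    show "s \<noteq> 0" "open_ball a s \<subseteq> X"
      using s(1) in_class B(1)[OF a(1)] by blast+
    fix y z y' z'
    assume yz: "y \<in> open_ball a s" "z \<in> open_ball a s" "y' \<in> open_ball a s" "z' \<in> open_ball a s"
    then have yzB: "y \<in> B" "z \<in> B" "y' \<in> B" "z' \<in> B"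
      using B(2)[OF a(1)] in_class by blast+
    show "f y \<noteq> f z" if "y \<noteq> z"
      \<comment> \<open>Comparing \<open>z\<close> with \<open>y\<close> itself, at distance
        \<open>Pinf\<close> from \<open>y\<close>, turns preservation of strict inequalities into
        injectivity.\<close>
      using iso[OF yzB(1,2,1)] that v_less_Pinf_iff by simp
    show "v (f y - f z) = v (f y' - f z')" if eq: "v (y - z) = v (y' - z')"
    proof (cases "y = z")
      case True
      then have "y' = z'"
        using eq v_eq_Pinf_iff[of "y' - z'"] by simp
      then show ?thesis
        using True by simp
    next
      case False
      define u where "u = z - y"
      have u: "u \<noteq> 0" "v s < v u" "z = y + u"
        using False yz v_less_trans[of "v s" z a y] v_commute[of a y] by (auto simp: u_def)
      then have "u \<in> Z a"
        using a(3) s(2) by (meson le_less_trans)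
      have y'u: "y' + u \<in> open_ball a d"
        using shift[OF in_class[OF yz(3)]] u(2) s(3) by (meson le_less_trans)
      \<comment> \<open>The pair \<open>(y, z)\<close> is translated to \<open>(y', y' + u)\<close>.
        Then \<open>y' + u\<close> is replaced by \<open>z'\<close>, which is equally far from
        \<open>y'\<close>, so the C-isomorphism gives equal distances of the images.\<close>
      have "v (f y - f z) = v (f y' - f (y' + u))"
        using \<open>u \<in> Z a\<close> in_class[OF yz(1)] in_class[OF yz(3)] yzB assms(4) B(1)[OF a(1) y'u]
        unfolding Z_def by (auto simp: graph_def u(3))
      moreover have "v (y' - z') = v (y' - (y' + u))"
        using eq u(3) by simp
      then have "v (f y' - f z') = v (f y' - f (y' + u))"
        using iso[OF yzB(3,4) B(2)[OF a(1) y'u]] iso[OF yzB(3) B(2)[OF a(1) y'u] yzB(4)]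
        by (metis linorder_neq_iff)
      ultimately show ?thesis
        by simp
    qed
  qed
  moreover have "a \<in> open_ball x c"
    using C(3)[OF a(1)] d(2) by auto
  ultimately show ?thesis
    by blast
qed

text \<open>The bad points form a definable set. If it were infinite it would contain a ball, and
  shrinking that ball into one where \<open>f\<close> is a C-isomorphism would produce a good point
  in it.\<close>

lemma finite_bad_points: "finite {x \<in> X. \<nexists>c. good x c}"
proof (rule ccontr)
  let ?F = "{x \<in> X. \<nexists>c. good x c}"
  assume inf: "infinite ?F"
  have "def_pred (\<lambda>e. (\<exists>a. graph (e 0) a) \<and> \<not> (\<exists>c. good (e 0) c))"
    by (intro def_intros def_pred_good)
  from uniformly_few_balls[OF this] obtain n where
    "few_balls n {x. (\<exists>a. graph x a) \<and> \<not> (\<exists>c. good x c)}"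
    by blast
  then have "few_balls n ?F"
    by (simp add: graph_def)
  then obtain x c where x: "x \<in> ?F" "c \<noteq> 0" "open_ball x c \<subseteq> ?F"
    using few_balls_infinite_interior inf by blast
  then obtain B where B: "is_open_ball v B" "x \<in> B" "B \<subseteq> X" "C_isomorphism v B f"
    using local_C_iso unfolding local_C_isomorphism_def by blast
  obtain d where d: "d \<noteq> 0" "open_ball x d \<subseteq> B"
    using open_ball_contains[OF B(1,2)] by blast
  obtain r where r: "r \<noteq> 0" "v c \<le> v r" "v d \<le> v r"
    using x(2) d(1) by (cases "v c \<le> v d") auto
  have "open_ball x r \<subseteq> open_ball x c" "open_ball x r \<subseteq> open_ball x d"
    using r(2,3) by (auto intro: le_less_trans)
  then show False
    using good_ball_in_C_isomorphism[OF B(4) r(1) _ B(3), of x] d(2) x(3) by blast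
qed

section \<open>The definable function on the value group\<close>

definition factor_rel :: "'a \<Rightarrow> 'g \<Rightarrow> 'g \<Rightarrow> bool" where
  "factor_rel x \<gamma> \<delta> \<longleftrightarrow> (\<exists>c w. good x c \<and> v c < Fin \<gamma> \<and> v (x - w) = Fin \<gamma> \<and> v (f x - f w) = Fin \<delta>)"

definition factor :: "'a \<Rightarrow> 'g \<Rightarrow> 'g option" where
  "factor x \<gamma> = (if \<exists>\<delta>. factor_rel x \<gamma> \<delta> then Some (SOME \<delta>. factor_rel x \<gamma> \<delta>) else None)"

lemma good_centre: "good x c \<Longrightarrow> x \<in> open_ball x c"
  by (simp add: good_def v_less_Pinf_iff)

text \<open>The condition \<open>v c < Fin \<gamma>\<close> puts every point at distance
  \<open>\<gamma>\<close> from \<open>x\<close> into the good ball of \<open>c\<close>, so both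
  witnesses can be compared there.\<close>

lemma factor_rel_unique:
  assumes "factor_rel x \<gamma> \<delta>" "factor_rel x \<gamma> \<delta>'"
  shows "\<delta> = \<delta>'"
proof -
  obtain c w c' w' where c: "good x c" "v c < Fin \<gamma>" and w: "v (x - w) = Fin \<gamma>"
    "v (f x - f w) = Fin \<delta>" and w': "v (x - w') = Fin \<gamma>" "v (f x - f w') = Fin \<delta>'"
    using assms unfolding factor_rel_def by blast
  have "w \<in> open_ball x c" "w' \<in> open_ball x c"
    using c w w' v_commute[of x w] v_commute[of x w'] by simp_all
  then have "v (f x - f w) = v (f x - f w')"
    using c(1) good_centre[OF c(1)] w(1) w'(1) unfolding good_def by (metis (no_types, lifting))
  then show ?thesis
    using w w' by simp
qed

lemma factor_eq_Some_iff: "factor x \<gamma> = Some \<delta> \<longleftrightarrow> factor_rel x \<gamma> \<delta>"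
  using factor_rel_unique someI[of "factor_rel x \<gamma>"] unfolding factor_def
  by (metis option.inject option.distinct(1))

lemma definable_factor: "definable_value_fun v L M factor"
proof -
  \<comment> \<open>The preimage of the graph of \<open>factor\<close> in the field, with
    \<open>y\<close> and \<open>z\<close> standing for their values.\<close>
  define Q where "Q x y z \<longleftrightarrow> y \<noteq> 0 \<and> z \<noteq> 0 \<and> (\<exists>c w a b. good x c \<and> v c < v y \<and>
    v (x - w) = v y \<and> graph x a \<and> graph w b \<and> v (a - b) = v z)" for x y z
  have "def_pred (\<lambda>e. Q (e 0) (e 1) (e 2))"
    unfolding Q_def by (intro def_intros def_pred_good)
  then have "definable L M 3 {[x, y, z] | x y z. Q x y z}"
    by (rule def_pred_imp_definable_3)
  moreover have "(\<exists>\<gamma> \<delta>. v y = Fin \<gamma> \<and> v z = Fin \<delta> \<and> factor x \<gamma> = Some \<delta>) \<longleftrightarrow> Q x y z" for x y z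
  proof
    assume "\<exists>\<gamma> \<delta>. v y = Fin \<gamma> \<and> v z = Fin \<delta> \<and> factor x \<gamma> = Some \<delta>"
    then obtain \<gamma> \<delta> where \<gamma>: "v y = Fin \<gamma>" "v z = Fin \<delta>" "factor_rel x \<gamma> \<delta>"
      by (auto simp: factor_eq_Some_iff)
    then have "y \<noteq> 0" "z \<noteq> 0"
      by auto
    moreover obtain c w where "good x c" "v c < v y" "v (x - w) = v y" "v (f x - f w) = v z"
      using \<gamma> unfolding factor_rel_def by metis
    moreover from this \<open>y \<noteq> 0\<close> have "x \<in> open_ball x c" "w \<in> open_ball x c"
      using good_centre v_commute[of x w] by auto
    then have "x \<in> X" "w \<in> X"
      using \<open>good x c\<close> unfolding good_def by blast+
    ultimately show "Q x y z"
      unfolding Q_def graph_def by blast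
  next
    assume "Q x y z"
    then obtain c w where Q: "y \<noteq> 0" "z \<noteq> 0" "good x c" "v c < v y" "v (x - w) = v y"
      "v (f x - f w) = v z"
      by (auto simp: Q_def graph_def)
    then obtain \<gamma> \<delta> where "v y = Fin \<gamma>" "v z = Fin \<delta>"
      using v_Fin by metis
    with Q show "\<exists>\<gamma> \<delta>. v y = Fin \<gamma> \<and> v z = Fin \<delta> \<and> factor x \<gamma> = Some \<delta>"
      unfolding factor_eq_Some_iff factor_rel_def by (metis (no_types, lifting))
  qed
  ultimately show ?thesis
    by (simp add: definable_value_fun_def)
qed

lemma locally_factorizes_factor: "locally_factorizes v (X - {x \<in> X. \<nexists>c. good x c}) f factor"
  unfolding locally_factorizes_def
proof (intro conjI allI impI ballI)
  fix x \<gamma>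
  assume "factor x \<gamma> \<noteq> None"
  then obtain c where "good x c"
    by (auto simp: factor_eq_Some_iff factor_rel_def)
  then show "x \<in> X - {x \<in> X. \<nexists>c. good x c}"
    using good_centre unfolding good_def by blast
next
  fix x
  assume "x \<in> X - {x \<in> X. \<nexists>c. good x c}"
  then obtain c where c: "good x c"
    by blast
  then have c0: "c \<noteq> 0" and sub: "open_ball x c \<subseteq> X"
    by (simp_all add: good_def)
  show "\<exists>B. is_open_ball v B \<and> x \<in> B \<and> B \<subseteq> X - {x \<in> X. \<nexists>c. good x c} \<and>
      factorizes v B f (factor x)"
  proof (intro exI[of _ "open_ball x c"] conjI)
    show "is_open_ball v (open_ball x c)" "x \<in> open_ball x c"
      using open_ball_is_open[OF c0] good_centre[OF c] by simp_all
    \<comment> \<open>Every point of a good ball is a centre of it and hence good with the same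
      \<open>c\<close>, so the ball avoids the exceptional set.\<close>
    show "open_ball x c \<subseteq> X - {x \<in> X. \<nexists>c. good x c}"
      using sub good_mono[OF c _ c0] open_ball_eq by blast
    show "factorizes v (open_ball x c) f (factor x)"
      unfolding factorizes_def
    proof (intro ballI impI)
      fix y z
      assume yz: "y \<in> open_ball x c" "z \<in> open_ball x c" "y \<noteq> z"
      then have "f y \<noteq> f z"
        using c unfolding good_def by blast
      then obtain \<gamma> \<delta> where v: "v (y - z) = Fin \<gamma>" "v (f y - f z) = Fin \<delta>"
        using v_Fin yz(3) by (metis right_minus_eq)
      \<comment> \<open>\<open>factor x\<close> is read off at the centre \<open>x\<close>, so the
        pair \<open>(y, z)\<close> is translated to \<open>(x, w)\<close> inside the good
        ball.\<close>
      define w where "w = x + (z - y)"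
      have \<gamma>: "v c < Fin \<gamma>" "v (x - w) = Fin \<gamma>"
        using yz v v_less_trans[of "v c" y x z] v_commute[of x z] by (simp_all add: w_def)
      then have "w \<in> open_ball x c"
        using v_commute[of x w] by simp
      then have "v (f x - f w) = v (f y - f z)"
        using c good_centre[OF c] yz v(1) \<gamma>(2) unfolding good_def by (metis (no_types, lifting))
      then have "factor_rel x \<gamma> \<delta>"
        unfolding factor_rel_def using c \<gamma> v(2) by metis
      then show "\<exists>\<gamma> \<delta>. v (y - z) = Fin \<gamma> \<and> factor x \<gamma> = Some \<delta> \<and> v (f y - f z) = Fin \<delta>"
        using v by (simp add: factor_eq_Some_iff)
    qed
  qed
qed

end

theorem theorem3p3:
  fixes v :: "'a::alg_closed_field \<Rightarrow> 'g::linordered_ab_group_add extended"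
    and L :: "('f vf_fun, 'r vf_rel) language"
    and M :: "('f vf_fun, 'r vf_rel, 'a) struct"
    and X :: "'a set"
    and f :: "'a \<Rightarrow> 'a"
  assumes "C_minimal_valued_field v L M"
    and "definable_fun L M X f"
    and "local_C_isomorphism v X f"
  shows "\<exists>F h. finite F \<and> F \<subseteq> X \<and> definable_value_fun v L M h \<and>
           locally_factorizes v (X - F) f h"
proof -
  interpret definable_local_C_isomorphism v L M X f
    using assms by unfold_locales
  show ?thesis
    using finite_bad_points definable_factor locally_factorizes_factor
    by (intro exI[of _ "{x \<in> X. \<nexists>c. good x c}"] exI[of _ factor]) blast
qed

end
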